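(* Consider the load-balancing online multiple knapsack problem with departures (defined in the context), and suppose that $\epsilon_k\le\frac{C_k\ln 2}{q_k\gamma_k}$ for all $k\in K$, where $\gamma_k=2\ln(2+4\bar\theta_k\bar d_k)$. Then Algorithm 2 outputs a feasible (integral) solution and has a competitive ratio of $O\big(\log(\bar\theta^{\max}\cdot\bar d^{\max})\big)$, where $\bar\theta^{\max}=\max_k\bar\theta_k$ and $\bar d^{\max}=\max_k\bar d_k$.
   Context: Problem. Finite set $K$ of resources with capacities $C_k>0$ and given positive integers $q_k$; discrete time horizon $T$; a set $N$ of requests, each with an arrival time $a_n\in T$; requests arrive in batches $N_i=\{n\in N:a_n=i\}$, $i\in T$. For each $n,k$: reward $v_{nk}\ge0$, demand $w_{nk}>0$, start slot $s_{nk}$, integer duration $d_{nk}\ge 1$, $T_{nk}=\{s_{nk},\dots,s_{nk}+d_{nk}-1\}\subseteq T$. When batch $N_i$ arrives, all data of its requests are revealed and the algorithm irrevocably decides for each $n\in N_i$ to reject it or assign it to one resource, without knowledge of future batches. A solution $x\in\{0,1\}^{N\times K}$ is feasible if $\sum_k x_{nk}\le1$ for all $n$, $\sum_{n:\,t\in T_{nk}}w_{nk}x_{nk}\le C_k$ for all $k,t$, and $\sum_{n\in N_i}x_{nk}\le q_k$ for all $k\in K$, $i\in T$; its value is $\sum_{n,k}v_{nk}x_{nk}$. Assumptions: (A1) $\theta_{nk}=\frac{v_{nk}}{w_{nk}d_{nk}}\in[\theta_k^{\min},\theta_k^{\max}]$ whenever $v_{nk}>0$, with $0<\theta_k^{\min}\le\theta_k^{\max}<\infty$,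 and $\theta_k^{\min}$, $\bar\theta_k=\theta_k^{\max}/\theta_k^{\min}$ known; (A2) $d_{nk}\in[d_k^{\min},d_k^{\max}]$, $\bar d_k=d_k^{\max}/d_k^{\min}$ finite and known; (A3) $w_{nk}\le\epsilon_k\le C_k$. Parameters: $\gamma_k=2\ln(2+4\bar\theta_k\bar d_k)$, $\mu_{nk}=e^{w_{nk}\gamma_k/C_k}$, $\beta_{nk}=\theta_k^{\min}(\mu_{nk}-1)$. Algorithm 2: initialize $x=0$, $p_{kt}=0$, $u_n=0$, $h_{ki}=0$. For each time $i\in T$ in order: with the current prices compute $r_{nk}=v_{nk}-w_{nk}\sum_{t\in T_{nk}}p_{kt}$ for $n\in N_i$, $k\in K$. Let $(P_i)$ be the LP: maximize $\sum_{n\in N_i,k\in K: r_{nk}>0}r_{nk}x_{nk}$ subject to $\sum_{n\in N_i}x_{nk}\le q_k$ ($k\in K$), $\sum_k x_{nk}\le1$ ($n\in N_i$), $x\ge0$ (variables only for pairs with $r_{nk}>0$), and $(D_i)$ its dual: minimize $\sum_{n\in N_i}u_n+\sum_k q_kh_{ki}$ subject to $u_n+h_{ki}\ge r_{nk}$ for all $n\in N_i,k$ with $r_{nk}>0$, $u,h\ge0$. Find an optimal integral solution $\bar x$ of $(P_i)$ (one exists since the constraint matrix is totally unimodular) and an optimal solution $(\bar u,\bar h)$ of $(D_i)$. Set $u_n=\bar u_n$ for $n\in N_i$ and $h_{ki}=\bar h_{ki}$ for $k\in K$; for each pair with $\bar x_{nk}=1$, set $x_{nk}=1$ and for each $t\in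 T_{nk}$ update $p_{kt}\leftarrow\mu_{nk}p_{kt}+\beta_{nk}$. Competitive ratio $\alpha$: for every instance satisfying the assumptions, the optimal offline value (maximum value of a feasible integral solution) is at most $\alpha$ times the value of the algorithm's solution. *)

theory Defs
  imports Complex_Main "HOL-Library.Landau_Symbols"
begin

text \<open>
  Requests and resources are labelled by natural numbers (any finite set can be so labelled).  Fixing
  the label types lets a single bound range over all instances: a constant obtained inside a
  polymorphic statement could depend on the type instantiation, hence on the number of resources.
\<close>

record mkp_instance =
  resources :: "nat set"
  requests :: "nat set"
  horizon :: nat
  capacity :: "nat \<Rightarrow> real"
  quota :: "nat \<Rightarrow> nat"
  arrival :: "nat \<Rightarrow> nat"
  reward :: "nat \<Rightarrow> nat \<Rightarrow> real"
  demand :: "nat \<Rightarrow> nat \<Rightarrow> real"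
  start :: "nat \<Rightarrow> nat \<Rightarrow> nat"
  duration :: "nat \<Rightarrow> nat \<Rightarrow> nat"
  theta_min :: "nat \<Rightarrow> real"
  theta_max :: "nat \<Rightarrow> real"
  dur_min :: "nat \<Rightarrow> real"
  dur_max :: "nat \<Rightarrow> real"
  demand_bound :: "nat \<Rightarrow> real"

definition time_slots :: "mkp_instance \<Rightarrow> nat set" where
  "time_slots I = {1..horizon I}"

definition batch :: "mkp_instance \<Rightarrow> nat \<Rightarrow> nat set" where
  "batch I i = {n \<in> requests I. arrival I n = i}"

definition slots :: "mkp_instance \<Rightarrow> nat \<Rightarrow> nat \<Rightarrow> nat set" where
  "slots I n k = {start I n k ..< start I n k + duration I n k}"

definition theta :: "mkp_instance \<Rightarrow> nat \<Rightarrow> nat \<Rightarrow> real" where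
  "theta I n k = reward I n k / (demand I n k * real (duration I n k))"

definition theta_ratio :: "mkp_instance \<Rightarrow> nat \<Rightarrow> real" where
  "theta_ratio I k = theta_max I k / theta_min I k"

definition dur_ratio :: "mkp_instance \<Rightarrow> nat \<Rightarrow> real" where
  "dur_ratio I k = dur_max I k / dur_min I k"

definition theta_ratio_max :: "mkp_instance \<Rightarrow> real" where
  "theta_ratio_max I = Max (theta_ratio I ` resources I)"

definition dur_ratio_max :: "mkp_instance \<Rightarrow> real" where
  "dur_ratio_max I = Max (dur_ratio I ` resources I)"

definition well_formed :: "mkp_instance \<Rightarrow> bool" where
  "well_formed I \<longleftrightarrow>
     finite (resources I) \<and> resources I \<noteq> {} \<and> finite (requests I) \<and>
     (\<forall>k\<in>resources I. capacity I k > 0 \<and> quota I k > 0) \<and>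
     (\<forall>n\<in>requests I. arrival I n \<in> time_slots I) \<and>
     (\<forall>n\<in>requests I. \<forall>k\<in>resources I.
        reward I n k \<ge> 0 \<and> demand I n k > 0 \<and> duration I n k \<ge> 1 \<and> slots I n k \<subseteq> time_slots I)"

definition density_assumption :: "mkp_instance \<Rightarrow> bool" where
  "density_assumption I \<longleftrightarrow>
     (\<forall>k\<in>resources I. 0 < theta_min I k \<and> theta_min I k \<le> theta_max I k) \<and>
     (\<forall>n\<in>requests I. \<forall>k\<in>resources I. reward I n k > 0 \<longrightarrow>
        theta I n k \<in> {theta_min I k..theta_max I k})"

definition duration_assumption :: "mkp_instance \<Rightarrow> bool" where
  "duration_assumption I \<longleftrightarrow>
     (\<forall>k\<in>resources I. 0 < dur_min I k \<and> dur_min I k \<le> dur_max I k) \<and>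
     (\<forall>n\<in>requests I. \<forall>k\<in>resources I.
        real (duration I n k) \<in> {dur_min I k..dur_max I k})"

definition demand_assumption :: "mkp_instance \<Rightarrow> bool" where
  "demand_assumption I \<longleftrightarrow>
     (\<forall>k\<in>resources I. demand_bound I k \<le> capacity I k) \<and>
     (\<forall>n\<in>requests I. \<forall>k\<in>resources I. demand I n k \<le> demand_bound I k)"

definition admissible :: "mkp_instance \<Rightarrow> bool" where
  "admissible I \<longleftrightarrow>
     well_formed I \<and> density_assumption I \<and> duration_assumption I \<and> demand_assumption I"

definition feasible :: "mkp_instance \<Rightarrow> (nat \<Rightarrow> nat \<Rightarrow> real) \<Rightarrow> bool" where
  "feasible I x \<longleftrightarrow>
     (\<forall>n\<in>requests I. \<forall>k\<in>resources I. x n k \<in> {0, 1}) \<and>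
     (\<forall>n\<in>requests I. (\<Sum>k\<in>resources I. x n k) \<le> 1) \<and>
     (\<forall>k\<in>resources I. \<forall>t\<in>time_slots I.
        (\<Sum>n | n \<in> requests I \<and> t \<in> slots I n k. demand I n k * x n k) \<le> capacity I k) \<and>
     (\<forall>k\<in>resources I. \<forall>i\<in>time_slots I. (\<Sum>n\<in>batch I i. x n k) \<le> real (quota I k))"

definition solution_value :: "mkp_instance \<Rightarrow> (nat \<Rightarrow> nat \<Rightarrow> real) \<Rightarrow> real" where
  "solution_value I x = (\<Sum>n\<in>requests I. \<Sum>k\<in>resources I. reward I n k * x n k)"

text \<open>
  Values of a solution outside \<open>requests I \<times> resources I\<close> are unconstrained but do not enter
  \<^const>\<open>solution_value\<close>, so the maximum below is over a finite set.
\<close>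

definition offline_opt :: "mkp_instance \<Rightarrow> real" where
  "offline_opt I = Max (solution_value I ` {x. feasible I x})"

definition gam :: "mkp_instance \<Rightarrow> nat \<Rightarrow> real" where
  "gam I k = 2 * ln (2 + 4 * theta_ratio I k * dur_ratio I k)"

definition mu :: "mkp_instance \<Rightarrow> nat \<Rightarrow> nat \<Rightarrow> real" where
  "mu I n k = exp (demand I n k * gam I k / capacity I k)"

definition beta :: "mkp_instance \<Rightarrow> nat \<Rightarrow> nat \<Rightarrow> real" where
  "beta I n k = theta_min I k * (mu I n k - 1)"

definition reduced_reward :: "mkp_instance \<Rightarrow> (nat \<Rightarrow> nat \<Rightarrow> real) \<Rightarrow> nat \<Rightarrow> nat \<Rightarrow> real" where
  "reduced_reward I p n k = reward I n k - demand I n k * (\<Sum>t\<in>slots I n k. p k t)"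

definition profitable :: "mkp_instance \<Rightarrow> (nat \<Rightarrow> nat \<Rightarrow> real) \<Rightarrow> nat \<Rightarrow> (nat \<times> nat) set" where
  "profitable I p i =
     {(n, k). n \<in> batch I i \<and> k \<in> resources I \<and> reduced_reward I p n k > 0}"

definition primal_feasible ::
    "mkp_instance \<Rightarrow> (nat \<Rightarrow> nat \<Rightarrow> real) \<Rightarrow> nat \<Rightarrow> (nat \<Rightarrow> nat \<Rightarrow> real) \<Rightarrow> bool" where
  "primal_feasible I p i x \<longleftrightarrow>
     (\<forall>k\<in>resources I. (\<Sum>n | (n, k) \<in> profitable I p i. x n k) \<le> real (quota I k)) \<and>
     (\<forall>n\<in>batch I i. (\<Sum>k | (n, k) \<in> profitable I p i. x n k) \<le> 1) \<and>
     (\<forall>(n, k)\<in>profitable I p i. 0 \<le> x n k)"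

definition primal_value ::
    "mkp_instance \<Rightarrow> (nat \<Rightarrow> nat \<Rightarrow> real) \<Rightarrow> nat \<Rightarrow> (nat \<Rightarrow> nat \<Rightarrow> real) \<Rightarrow> real" where
  "primal_value I p i x = (\<Sum>(n, k)\<in>profitable I p i. reduced_reward I p n k * x n k)"

definition primal_optimal ::
    "mkp_instance \<Rightarrow> (nat \<Rightarrow> nat \<Rightarrow> real) \<Rightarrow> nat \<Rightarrow> (nat \<Rightarrow> nat \<Rightarrow> real) \<Rightarrow> bool" where
  "primal_optimal I p i x \<longleftrightarrow>
     primal_feasible I p i x \<and>
     (\<forall>y. primal_feasible I p i y \<longrightarrow> primal_value I p i y \<le> primal_value I p i x)"

definition dual_feasible ::
    "mkp_instance \<Rightarrow> (nat \<Rightarrow> nat \<Rightarrow> real) \<Rightarrow> nat \<Rightarrow> (nat \<Rightarrow> real) \<Rightarrow> (nat \<Rightarrow> real) \<Rightarrow> bool" where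
  "dual_feasible I p i u h \<longleftrightarrow>
     (\<forall>(n, k)\<in>profitable I p i. u n + h k \<ge> reduced_reward I p n k) \<and>
     (\<forall>n\<in>batch I i. 0 \<le> u n) \<and> (\<forall>k\<in>resources I. 0 \<le> h k)"

definition dual_value ::
    "mkp_instance \<Rightarrow> nat \<Rightarrow> (nat \<Rightarrow> real) \<Rightarrow> (nat \<Rightarrow> real) \<Rightarrow> real" where
  "dual_value I i u h = (\<Sum>n\<in>batch I i. u n) + (\<Sum>k\<in>resources I. real (quota I k) * h k)"

definition dual_optimal ::
    "mkp_instance \<Rightarrow> (nat \<Rightarrow> nat \<Rightarrow> real) \<Rightarrow> nat \<Rightarrow> (nat \<Rightarrow> real) \<Rightarrow> (nat \<Rightarrow> real) \<Rightarrow> bool" where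
  "dual_optimal I p i u h \<longleftrightarrow>
     dual_feasible I p i u h \<and>
     (\<forall>u' h'. dual_feasible I p i u' h' \<longrightarrow> dual_value I i u h \<le> dual_value I i u' h')"

record alg_state =
  sol :: "nat \<Rightarrow> nat \<Rightarrow> real"
  price :: "nat \<Rightarrow> nat \<Rightarrow> real"
  req_dual :: "nat \<Rightarrow> real"
  res_dual :: "nat \<Rightarrow> nat \<Rightarrow> real"

definition init_state :: alg_state where
  "init_state = \<lparr>sol = \<lambda>n k. 0, price = \<lambda>k t. 0, req_dual = \<lambda>n. 0, res_dual = \<lambda>k i. 0\<rparr>"

definition price_update ::
    "mkp_instance \<Rightarrow> nat \<times> nat \<Rightarrow> (nat \<Rightarrow> nat \<Rightarrow> real) \<Rightarrow> (nat \<Rightarrow> nat \<Rightarrow> real)" where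
  "price_update I = (\<lambda>(n, k) p k' t.
     if k' = k \<and> t \<in> slots I n k then mu I n k * p k' t + beta I n k else p k' t)"

text \<open>
  The algorithm leaves open which optimal solutions of the two linear programs are taken and in
  which order the accepted pairs (listed by \<open>ps\<close>) are processed, so a step is a relation.
\<close>

definition alg_step :: "mkp_instance \<Rightarrow> nat \<Rightarrow> alg_state \<Rightarrow> alg_state \<Rightarrow> bool" where
  "alg_step I i \<sigma> \<sigma>' \<longleftrightarrow>
     (\<exists>x u h ps.
        primal_optimal I (price \<sigma>) i x \<and>
        (\<forall>(n, k)\<in>profitable I (price \<sigma>) i. x n k \<in> \<int>) \<and>
        dual_optimal I (price \<sigma>) i u h \<and>
        distinct ps \<and> set ps = {(n, k) \<in> profitable I (price \<sigma>) i. x n k = 1} \<and>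
        \<sigma>' = \<lparr>sol = \<lambda>n k. if (n, k) \<in> set ps then 1 else sol \<sigma> n k,
              price = fold (price_update I) ps (price \<sigma>),
              req_dual = \<lambda>n. if n \<in> batch I i then u n else req_dual \<sigma> n,
              res_dual = \<lambda>k j. if k \<in> resources I \<and> j = i then h k else res_dual \<sigma> k j\<rparr>)"

inductive alg_run :: "mkp_instance \<Rightarrow> nat \<Rightarrow> alg_state \<Rightarrow> bool" for I where
  init: "alg_run I 0 init_state"
| step: "alg_run I i \<sigma> \<Longrightarrow> alg_step I (Suc i) \<sigma> \<sigma>' \<Longrightarrow> alg_run I (Suc i) \<sigma>'"

definition alg_output :: "mkp_instance \<Rightarrow> (nat \<Rightarrow> nat \<Rightarrow> real) \<Rightarrow> bool" where
  "alg_output I x \<longleftrightarrow> (\<exists>\<sigma>. alg_run I (horizon I) \<sigma> \<and> x = sol \<sigma>)"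

definition small_demands :: "mkp_instance \<Rightarrow> bool" where
  "small_demands I \<longleftrightarrow>
     (\<forall>k\<in>resources I. demand_bound I k \<le> capacity I k * ln 2 / (real (quota I k) * gam I k))"

definition competitive_ratio :: "mkp_instance set \<Rightarrow> real \<Rightarrow> bool" where
  "competitive_ratio \<I> a \<longleftrightarrow>
     (\<forall>I\<in>\<I>. \<forall>x. alg_output I x \<longrightarrow> offline_opt I \<le> a * solution_value I x)"

end

theory Submission
  imports Defs "HOL-Library.FuncSet" "HOL-Real_Asymp.Real_Asymp"
begin

text \<open>
  Each batch is a weighted bipartite assignment problem with quotas; it has an integral optimum and
  dual prices of the same value, so the algorithm can always proceed.

  The update rule keeps \<open>p k t = theta_min k * (exp (gam k * L / C k) - 1)\<close>, where \<open>L\<close> is the load of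
  resource \<open>k\<close> in slot \<open>t\<close>, and by smallness of the demands a single batch multiplies
  \<open>p k t + theta_min k\<close> by at most 2.

  Feasibility: once the accepted requests covering all of a block of at least \<open>dur_min / 2\<close> slots use
  almost half of the capacity, the prices in the block make every further request covering it
  unprofitable. A request covering a slot \<open>t\<close> covers one of two such blocks, one beginning and one
  ending in \<open>t\<close>, and together these account for at most the full capacity.

  Competitiveness: the variables \<open>u\<close>, \<open>h\<close>, \<open>p\<close> form a feasible solution of the dual of the offline
  linear program, and each batch increases its value by at most \<open>1 + 4 * gam\<close> times the accepted
  reward.
\<close>

section \<open>Duality for assignments with capacities\<close>

text \<open>
  A list of agents encodes a chain of reassignments of \<open>f\<close>: each agent moves to the current place of
  the next one, the last one moves to \<open>y\<close>. The chain frees one unit of its starting place.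
\<close>

context
  fixes f :: "'a \<Rightarrow> 'j" and w :: "'a \<Rightarrow> 'j \<Rightarrow> real"
begin

fun chain_start :: "'a list \<Rightarrow> 'j \<Rightarrow> 'j" where
  "chain_start [] y = y"
| "chain_start (n # ns) y = f n"

fun chain_loss :: "'a list \<Rightarrow> 'j \<Rightarrow> real" where
  "chain_loss [] y = 0"
| "chain_loss (n # ns) y = w n (f n) - w n (chain_start ns y) + chain_loss ns y"

fun reassign :: "'a list \<Rightarrow> 'j \<Rightarrow> 'a \<Rightarrow> 'j" where
  "reassign [] y = f"
| "reassign (n # ns) y = (reassign ns y)(n := chain_start ns y)"

lemma chain_start_append_Cons: "chain_start (xs @ n # ys) y = chain_start xs (f n)"
  by (cases xs) auto

lemma chain_loss_append_Cons:
  "chain_loss (xs @ n # ys) y = chain_loss xs (f n) + chain_loss (n # ys) y"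
  by (induction xs) (auto simp: chain_start_append_Cons)

lemma chain_loss_remove_cycle:
  "chain_loss (xs @ n # ys @ n # zs) y = chain_loss (xs @ n # zs) y + chain_loss (n # ys) (f n)"
  using chain_loss_append_Cons[of xs n "ys @ n # zs" y] chain_loss_append_Cons[of "n # ys" n zs y]
    chain_loss_append_Cons[of xs n zs y]
  by simp

lemma reassign_notin: "n \<notin> set ns \<Longrightarrow> reassign ns y n = f n"
  by (induction ns) auto

lemma reassign_in: "n \<in> N \<Longrightarrow> set ns \<subseteq> N \<Longrightarrow> reassign ns y n \<in> insert y (f ` N)"
proof (induction ns)
  case (Cons m ns)
  then show ?case by (cases ns) auto
qed simp

lemma sum_reassign:
  assumes "finite N" "set ns \<subseteq> N" "distinct ns"
  shows "(\<Sum>n\<in>N. w n (reassign ns y n)) = (\<Sum>n\<in>N. w n (f n)) - chain_loss ns y"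
  using assms(2,3)
proof (induction ns)
  case (Cons m ns)
  let ?g = "reassign ns y"
  have "(\<Sum>n\<in>N. w n (reassign (m # ns) y n)) =
      w m (chain_start ns y) + (\<Sum>n\<in>N - {m}. w n (?g n))"
    using Cons.prems assms(1) by (subst sum.remove[of _ m]) auto
  also have "\<dots> = w m (chain_start ns y) - w m (f m) + (\<Sum>n\<in>N. w n (?g n))"
    using Cons.prems assms(1) by (subst sum.remove[of N m]) (auto simp: reassign_notin)
  finally show ?case using Cons by simp
qed simp

end

definition occupancy :: "'a set \<Rightarrow> ('a \<Rightarrow> 'j) \<Rightarrow> 'j \<Rightarrow> nat" where
  "occupancy N f j = card {n \<in> N. f n = j}"

lemma occupancy_conv_sum: "finite N \<Longrightarrow> real (occupancy N f j) = (\<Sum>n\<in>N. of_bool (f n = j))"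
  by (simp add: occupancy_def Int_def)

lemma occupancy_reassign:
  assumes "finite N" "set ns \<subseteq> N" "distinct ns"
  shows "real (occupancy N (reassign f ns y) j) =
    real (occupancy N f j) - of_bool (chain_start f ns y = j) + of_bool (y = j)"
proof -
  let ?w = "\<lambda>(_ :: 'a) x. of_bool (x = j) :: real"
  have "chain_loss f ?w ns y = of_bool (chain_start f ns y = j) - of_bool (y = j)"
    by (induction ns) auto
  then show ?thesis
    using sum_reassign[OF assms, of ?w f y] assms(1) by (simp add: occupancy_conv_sum)
qed

definition assignments :: "'a set \<Rightarrow> 'j set \<Rightarrow> ('j \<Rightarrow> nat) \<Rightarrow> ('a \<Rightarrow> 'j) set" where
  "assignments N J c = {f \<in> N \<rightarrow> J. \<forall>j\<in>J. occupancy N f j \<le> c j}"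

locale optimal_assignment =
  fixes N :: "'a set" and J :: "'j set" and c :: "'j \<Rightarrow> nat" and w :: "'a \<Rightarrow> 'j \<Rightarrow> real"
    and f :: "'a \<Rightarrow> 'j" and z :: 'j
  assumes finite_agents: "finite N" and finite_places: "finite J"
    and places_pos: "j \<in> J \<Longrightarrow> 0 < c j"
    and reserve_place: "z \<in> J" "card N < c z"
    and assignment: "f \<in> assignments N J c"
    and optimal: "g \<in> assignments N J c \<Longrightarrow> (\<Sum>n\<in>N. w n (g n)) \<le> (\<Sum>n\<in>N. w n (f n))"
begin

lemma place_in: "n \<in> N \<Longrightarrow> f n \<in> J"
  and occupancy_le: "j \<in> J \<Longrightarrow> occupancy N f j \<le> c j"
  using assignment by (auto simp: assignments_def)

definition spare :: "'j set" where
  "spare = {j \<in> J. occupancy N f j < c j}"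

lemma reserve_place_spare: "z \<in> spare"
proof -
  have "occupancy N f z \<le> card N"
    unfolding occupancy_def using finite_agents by (intro card_mono) auto
  then show ?thesis using reserve_place by (simp add: spare_def)
qed

lemma chain_loss_nonneg_if_distinct:
  assumes ns: "set ns \<subseteq> N" "distinct ns" and y: "y \<in> spare \<or> y \<in> J \<and> y = chain_start f ns y"
  shows "0 \<le> chain_loss f w ns y"
proof -
  have "reassign f ns y \<in> assignments N J c"
    unfolding assignments_def
  proof (intro CollectI conjI ballI)
    show "reassign f ns y \<in> N \<rightarrow> J"
      using reassign_in[OF _ ns(1), of _ f y] place_in y by (fastforce simp: spare_def)
    show "occupancy N (reassign f ns y) j \<le> c j" if "j \<in> J" for j
      using occupancy_reassign[OF finite_agents ns, of f y j] occupancy_le[OF that] y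
      by (auto simp: spare_def of_bool_def split: if_splits)
  qed
  then show ?thesis using optimal sum_reassign[OF finite_agents ns, of w f y] by fastforce
qed

lemma chain_loss_nonneg:
  assumes "set ns \<subseteq> N" "y \<in> spare \<or> y \<in> J \<and> y = chain_start f ns y"
  shows "0 \<le> chain_loss f w ns y"
  using assms
proof (induction "length ns" arbitrary: ns y rule: less_induct)
  case less
  show ?case
  proof (cases "distinct ns")
    case True
    then show ?thesis using chain_loss_nonneg_if_distinct less.prems by blast
  next
    case False
    then obtain xs ys zs n where ns: "ns = xs @ n # ys @ n # zs"
      using not_distinct_decomp[of ns] by auto
    have "0 \<le> chain_loss f w (n # ys) (f n)"
      using less.prems place_in by (intro less.hyps) (auto simp: ns)
    moreover have "0 \<le> chain_loss f w (xs @ n # zs) y"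
      using less.prems by (intro less.hyps) (auto simp: ns chain_start_append_Cons)
    ultimately show ?thesis by (simp add: ns chain_loss_remove_cycle)
  qed
qed

definition release_losses :: "'j \<Rightarrow> real set" where
  "release_losses j =
     {chain_loss f w ns y | ns y. set ns \<subseteq> N \<and> y \<in> spare \<and> chain_start f ns y = j}"

text \<open>
  The price of a place is the cheapest loss incurred by freeing one unit of it through a chain of
  reassignments ending in a place with spare capacity; optimality makes every such loss nonnegative.
\<close>

definition place_price :: "'j \<Rightarrow> real" where
  "place_price j = Inf (release_losses j)"

lemma release_lossesI:
  "set ns \<subseteq> N \<Longrightarrow> y \<in> spare \<Longrightarrow> chain_loss f w ns y \<in> release_losses (chain_start f ns y)"
  by (auto simp: release_losses_def)

lemma release_losses_nonneg: "x \<in> release_losses j \<Longrightarrow> 0 \<le> x"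
  using chain_loss_nonneg by (auto simp: release_losses_def)

lemma release_losses_nonempty:
  assumes "j \<in> J"
  shows "release_losses j \<noteq> {}"
proof (cases "j \<in> spare")
  case True
  then show ?thesis using release_lossesI[of "[]" j] by auto
next
  case False
  then have "0 < occupancy N f j" using assms places_pos by (force simp: spare_def)
  then obtain n where "n \<in> N" "f n = j" by (auto simp: occupancy_def card_gt_0_iff)
  then show ?thesis using release_lossesI[of "[n]" z] reserve_place_spare by auto
qed

lemma place_price_le: "x \<in> release_losses j \<Longrightarrow> place_price j \<le> x"
  unfolding place_price_def using release_losses_nonneg
  by (intro cInf_lower) (auto intro!: bdd_belowI)

lemma place_price_nonneg: "j \<in> J \<Longrightarrow> 0 \<le> place_price j"
  unfolding place_price_def
  using release_losses_nonempty release_losses_nonneg by (rule cInf_greatest)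

lemma place_price_spare:
  assumes "j \<in> spare"
  shows "place_price j = 0"
  using place_price_le[of 0 j] place_price_nonneg[of j] release_lossesI[of "[]" j] assms
  by (auto simp: spare_def)

lemma place_price_stable:
  assumes n: "n \<in> N" and j: "j \<in> J"
  shows "w n j - place_price j \<le> w n (f n) - place_price (f n)"
proof -
  have "place_price (f n) - w n (f n) + w n j \<le> place_price j"
    unfolding place_price_def[of j] using release_losses_nonempty[OF j]
  proof (rule cInf_greatest)
    fix x assume "x \<in> release_losses j"
    then obtain ns y
      where "x = chain_loss f w ns y" "set ns \<subseteq> N" "y \<in> spare" "chain_start f ns y = j"
      by (auto simp: release_losses_def)
    then show "place_price (f n) - w n (f n) + w n j \<le> x"
      using place_price_le[OF release_lossesI[of "n # ns" y]] n by simp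
  qed
  then show ?thesis by simp
qed

lemma sum_place_price: "(\<Sum>n\<in>N. place_price (f n)) = (\<Sum>j\<in>J. real (c j) * place_price j)"
proof -
  have "(\<Sum>n\<in>N. place_price (f n)) = (\<Sum>j\<in>J. \<Sum>n | n \<in> N \<and> f n = j. place_price (f n))"
    using finite_agents finite_places place_in by (intro sum.group[symmetric]) auto
  also have "\<dots> = (\<Sum>j\<in>J. real (occupancy N f j) * place_price j)"
    by (simp add: occupancy_def)
  also have "\<dots> = (\<Sum>j\<in>J. real (c j) * place_price j)"
    using occupancy_le place_price_spare by (intro sum.cong) (fastforce simp: spare_def)+
  finally show ?thesis .
qed

end

lemma optimal_assignment_exists:
  fixes w :: "'a \<Rightarrow> 'j \<Rightarrow> real"
  assumes "finite N" "finite J" "z \<in> J" "card N \<le> c z"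
  obtains f where "f \<in> assignments N J c"
    "\<And>g. g \<in> assignments N J c \<Longrightarrow> (\<Sum>n\<in>N. w n (g n)) \<le> (\<Sum>n\<in>N. w n (f n))"
proof -
  let ?F = "assignments N J c" and ?v = "\<lambda>g. \<Sum>n\<in>N. w n (g n)"
  have "?v ` ?F \<subseteq> ?v ` (N \<rightarrow>\<^sub>E J)"
  proof
    fix r assume "r \<in> ?v ` ?F"
    then obtain g where "g \<in> N \<rightarrow> J" "r = ?v g" by (auto simp: assignments_def)
    then show "r \<in> ?v ` (N \<rightarrow>\<^sub>E J)" by (intro image_eqI[of _ _ "restrict g N"]) auto
  qed
  then have fin: "finite (?v ` ?F)"
    by (rule finite_subset) (simp add: finite_PiE assms(1,2))
  have "occupancy N (\<lambda>_. z) j = (if z = j then card N else 0)" for j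
    by (simp add: occupancy_def)
  then have "(\<lambda>_. z) \<in> ?F" using assms(3,4) by (simp add: assignments_def)
  then have "Max (?v ` ?F) \<in> ?v ` ?F" using fin by (intro Max_in) auto
  then obtain f where "f \<in> ?F" "?v f = Max (?v ` ?F)" by auto
  then show thesis using that fin by simp
qed

theorem assignment_duality:
  fixes w :: "'a \<Rightarrow> 'j \<Rightarrow> real" and c :: "'j \<Rightarrow> nat"
  assumes "finite N" "finite J" "\<And>j. j \<in> J \<Longrightarrow> 0 < c j" "z \<in> J" "card N < c z"
  obtains f u h where "f \<in> assignments N J c"
    "\<And>n j. n \<in> N \<Longrightarrow> j \<in> J \<Longrightarrow> w n j \<le> u n + h j" "\<And>j. j \<in> J \<Longrightarrow> 0 \<le> h j" "h z = 0"
    "(\<Sum>n\<in>N. w n (f n)) = (\<Sum>n\<in>N. u n) + (\<Sum>j\<in>J. real (c j) * h j)"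
proof -
  obtain f where f: "f \<in> assignments N J c"
      "\<And>g. g \<in> assignments N J c \<Longrightarrow> (\<Sum>n\<in>N. w n (g n)) \<le> (\<Sum>n\<in>N. w n (f n))"
    using optimal_assignment_exists[of N J z c w] assms by auto
  interpret optimal_assignment N J c w f z
    using assms f by unfold_locales auto
  define u where "u n = w n (f n) - place_price (f n)" for n
  show thesis
  proof (rule that[OF f(1)])
    show "w n j \<le> u n + place_price j" if "n \<in> N" "j \<in> J" for n j
      using place_price_stable[OF that] by (simp add: u_def)
    show "(\<Sum>n\<in>N. w n (f n)) = (\<Sum>n\<in>N. u n) + (\<Sum>j\<in>J. real (c j) * place_price j)"
      by (simp add: u_def sum_subtractf sum_place_price)
  qed (simp_all add: place_price_nonneg place_price_spare reserve_place_spare)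
qed

section \<open>The linear programs of a batch\<close>

lemma dual_optimal_cong:
  assumes "\<And>n. n \<in> batch I i \<Longrightarrow> u n = u' n" "\<And>k. k \<in> resources I \<Longrightarrow> h k = h' k"
  shows "dual_optimal I p i u h \<longleftrightarrow> dual_optimal I p i u' h'"
proof -
  have "dual_value I i u h = dual_value I i u' h'"
    using assms by (simp add: dual_value_def)
  moreover have "dual_feasible I p i u h \<longleftrightarrow> dual_feasible I p i u' h'"
    using assms by (auto simp: dual_feasible_def profitable_def)
  ultimately show ?thesis by (simp add: dual_optimal_def)
qed

lemma primal_optimal_cong:
  assumes "\<And>n k. (n, k) \<in> profitable I p i \<Longrightarrow> x n k = y n k"
  shows "primal_optimal I p i x \<longleftrightarrow> primal_optimal I p i y"
proof -
  have "primal_value I p i x = primal_value I p i y"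
    unfolding primal_value_def using assms by (intro sum.cong) auto
  moreover have "primal_feasible I p i x \<longleftrightarrow> primal_feasible I p i y"
    using assms by (auto simp: primal_feasible_def)
  ultimately show ?thesis by (simp add: primal_optimal_def)
qed

locale well_formed_instance =
  fixes I :: mkp_instance
  assumes well_formed: "well_formed I"
begin

lemma finite_resources: "finite (resources I)"
  and finite_requests: "finite (requests I)"
  and finite_batch: "finite (batch I i)"
  using well_formed by (auto simp: well_formed_def batch_def)

lemma capacity_pos: "k \<in> resources I \<Longrightarrow> 0 < capacity I k"
  and quota_pos: "k \<in> resources I \<Longrightarrow> 0 < quota I k"
  using well_formed by (auto simp: well_formed_def)

lemma demand_pos: "n \<in> requests I \<Longrightarrow> k \<in> resources I \<Longrightarrow> 0 < demand I n k"
  and reward_nonneg: "n \<in> requests I \<Longrightarrow> k \<in> resources I \<Longrightarrow> 0 \<le> reward I n k"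
  and duration_ge_1: "n \<in> requests I \<Longrightarrow> k \<in> resources I \<Longrightarrow> 1 \<le> duration I n k"
  and slots_subset: "n \<in> requests I \<Longrightarrow> k \<in> resources I \<Longrightarrow> slots I n k \<subseteq> time_slots I"
  and arrival_slot: "n \<in> requests I \<Longrightarrow> arrival I n \<in> time_slots I"
  using well_formed by (auto simp: well_formed_def)

lemma profitable_subset: "profitable I p i \<subseteq> batch I i \<times> resources I"
  by (auto simp: profitable_def)

lemma batch_subset: "batch I i \<subseteq> requests I"
  by (auto simp: batch_def)

lemma finite_profitable: "finite (profitable I p i)"
  using profitable_subset finite_batch finite_resources by (meson finite_SigmaI finite_subset)

lemma finite_profitable_resources: "finite {k. (n, k) \<in> profitable I p i}"
  by (rule finite_subset[OF _ finite_resources]) (use profitable_subset in blast)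

lemma sum_profitable_by_request:
  "(\<Sum>(n, k)\<in>profitable I p i. g n k) =
    (\<Sum>n\<in>batch I i. \<Sum>k | (n, k) \<in> profitable I p i. g n k)"
proof -
  have "profitable I p i = Sigma (batch I i) (\<lambda>n. {k. (n, k) \<in> profitable I p i})"
    using profitable_subset by blast
  then show ?thesis
    using sum.Sigma[of "batch I i" "\<lambda>n. {k. (n, k) \<in> profitable I p i}" g]
    by (simp add: finite_batch finite_profitable_resources)
qed

lemma sum_profitable_by_resource:
  "(\<Sum>(n, k)\<in>profitable I p i. g n k) =
    (\<Sum>k\<in>resources I. \<Sum>n | (n, k) \<in> profitable I p i. g n k)"
proof -
  let ?P = "profitable I p i"
  have "{k. (n, k) \<in> ?P} = {k \<in> resources I. (n, k) \<in> ?P}"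
    "{n. (n, k) \<in> ?P} = {n \<in> batch I i. (n, k) \<in> ?P}" for n k
    using profitable_subset by blast+
  then show ?thesis
    unfolding sum_profitable_by_request
    by (simp only: sum.swap_restrict[OF finite_batch finite_resources])
qed

lemma weak_duality:
  assumes x: "primal_feasible I p i x" and uh: "dual_feasible I p i u h"
  shows "primal_value I p i x \<le> dual_value I i u h"
proof -
  let ?P = "profitable I p i"
  have "primal_value I p i x \<le> (\<Sum>(n, k)\<in>?P. (u n + h k) * x n k)"
    unfolding primal_value_def using x uh
    by (intro sum_mono) (auto simp: primal_feasible_def dual_feasible_def intro!: mult_right_mono)
  also have "\<dots> = (\<Sum>(n, k)\<in>?P. u n * x n k) + (\<Sum>(n, k)\<in>?P. h k * x n k)"
    by (simp add: sum.distrib[symmetric] case_prod_unfold distrib_right)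
  also have "(\<Sum>(n, k)\<in>?P. u n * x n k) = (\<Sum>n\<in>batch I i. u n * (\<Sum>k | (n, k) \<in> ?P. x n k))"
    by (simp add: sum_profitable_by_request sum_distrib_left)
  also have "(\<Sum>(n, k)\<in>?P. h k * x n k) = (\<Sum>k\<in>resources I. h k * (\<Sum>n | (n, k) \<in> ?P. x n k))"
    by (simp add: sum_profitable_by_resource sum_distrib_left)
  also have "(\<Sum>n\<in>batch I i. u n * (\<Sum>k | (n, k) \<in> ?P. x n k)) \<le> (\<Sum>n\<in>batch I i. u n * 1)"
    using x uh by (intro sum_mono mult_left_mono) (auto simp: primal_feasible_def dual_feasible_def)
  also have "(\<Sum>k\<in>resources I. h k * (\<Sum>n | (n, k) \<in> ?P. x n k)) \<le>
      (\<Sum>k\<in>resources I. h k * real (quota I k))"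
    using x uh by (intro sum_mono mult_left_mono) (auto simp: primal_feasible_def dual_feasible_def)
  finally show ?thesis by (simp add: dual_value_def mult.commute)
qed

lemma primal_feasible_assignment:
  assumes "\<And>k. k \<in> resources I \<Longrightarrow> occupancy (batch I i) f (Some k) \<le> quota I k"
  shows "primal_feasible I p i (\<lambda>n k. of_bool (f n = Some k))"
  unfolding primal_feasible_def
proof (intro conjI ballI)
  let ?P = "profitable I p i"
  show "(\<Sum>n | (n, k) \<in> ?P. of_bool (f n = Some k)) \<le> real (quota I k)" if "k \<in> resources I" for k
  proof -
    have "(\<Sum>n | (n, k) \<in> ?P. of_bool (f n = Some k)) \<le> real (occupancy (batch I i) f (Some k))"
      unfolding occupancy_conv_sum[OF finite_batch] using finite_batch profitable_subset
      by (intro sum_mono2) auto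
    also have "\<dots> \<le> real (quota I k)" using assms[OF that] by simp
    finally show ?thesis .
  qed
  show "(\<Sum>k | (n, k) \<in> ?P. of_bool (f n = Some k)) \<le> (1 :: real)" for n
  proof (cases "f n")
    case (Some k)
    then show ?thesis by (simp add: finite_profitable_resources of_bool_def)
  qed simp
qed auto

lemma primal_value_assignment:
  "primal_value I p i (\<lambda>n k. of_bool (f n = Some k)) = (\<Sum>n\<in>batch I i. case f n of None \<Rightarrow> 0
    | Some k \<Rightarrow> if (n, k) \<in> profitable I p i then reduced_reward I p n k else 0)"
  unfolding primal_value_def sum_profitable_by_request
proof (rule sum.cong)
  fix n
  show "(\<Sum>k | (n, k) \<in> profitable I p i. reduced_reward I p n k * of_bool (f n = Some k)) =
      (case f n of None \<Rightarrow> 0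
        | Some k \<Rightarrow> if (n, k) \<in> profitable I p i then reduced_reward I p n k else 0)"
  proof (cases "f n")
    case (Some k)
    then show ?thesis by (simp add: finite_profitable_resources of_bool_def if_distrib cong: if_cong)
  qed simp
qed simp

text \<open>The place \<^const>\<open>None\<close> of the assignment problem takes all rejected requests.\<close>

theorem integral_strong_duality:
  obtains x u h where "primal_feasible I p i x" "\<And>n k. x n k \<in> \<int>"
    "dual_feasible I p i u h" "primal_value I p i x = dual_value I i u h"
proof -
  let ?P = "profitable I p i" and ?J = "insert None (Some ` resources I)"
  define w where "w n j =
    (case j of None \<Rightarrow> 0 | Some k \<Rightarrow> if (n, k) \<in> ?P then reduced_reward I p n k else 0)" for n j
  define c where "c j = (case j of None \<Rightarrow> Suc (card (batch I i)) | Some k \<Rightarrow> quota I k)" for j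
  have places: "finite ?J" "\<And>j. j \<in> ?J \<Longrightarrow> 0 < c j" "None \<in> ?J" "card (batch I i) < c None"
    using well_formed by (auto simp: c_def well_formed_def)
  obtain f u h where f: "f \<in> assignments (batch I i) ?J c"
    and uh: "\<And>n j. n \<in> batch I i \<Longrightarrow> j \<in> ?J \<Longrightarrow> w n j \<le> u n + h j"
      "\<And>j. j \<in> ?J \<Longrightarrow> 0 \<le> h j" "h None = 0"
    and val: "(\<Sum>n\<in>batch I i. w n (f n)) = (\<Sum>n\<in>batch I i. u n) + (\<Sum>j\<in>?J. real (c j) * h j)"
    by (rule assignment_duality[of "batch I i" ?J c None w])
      (use finite_batch places in \<open>blast intro: that\<close>)+
  show thesis
  proof (rule that[of "\<lambda>n k. of_bool (f n = Some k)" u "\<lambda>k. h (Some k)"])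
    show "primal_feasible I p i (\<lambda>n k. of_bool (f n = Some k))"
      by (rule primal_feasible_assignment) (use f in \<open>simp add: assignments_def c_def\<close>)
    show "dual_feasible I p i u (\<lambda>k. h (Some k))"
      unfolding dual_feasible_def
    proof (intro conjI ballI, clarify)
      fix n k assume "(n, k) \<in> ?P"
      then show "reduced_reward I p n k \<le> u n + h (Some k)"
        using uh(1)[of n "Some k"] profitable_subset by (auto simp: w_def)
    next
      fix n assume "n \<in> batch I i"
      then show "0 \<le> u n" using uh(1)[of n None] uh(3) by (simp add: w_def)
    qed (simp add: uh(2))
    have "(\<Sum>j\<in>?J. real (c j) * h j) = (\<Sum>k\<in>resources I. real (quota I k) * h (Some k))"
      by (simp add: finite_resources sum.reindex uh(3) c_def)
    then show "primal_value I p i (\<lambda>n k. of_bool (f n = Some k)) =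
        dual_value I i u (\<lambda>k. h (Some k))"
      using val by (simp add: primal_value_assignment dual_value_def w_def)
  qed simp
qed

lemma optimal_values_eq:
  assumes "primal_optimal I p i x" "dual_optimal I p i u h"
  shows "primal_value I p i x = dual_value I i u h"
proof -
  obtain y v g where y: "primal_feasible I p i y" and vg: "dual_feasible I p i v g"
    and eq: "primal_value I p i y = dual_value I i v g"
    by (rule integral_strong_duality[of p i])
  have "primal_value I p i y \<le> primal_value I p i x"
    using assms(1) y by (simp add: primal_optimal_def)
  moreover have "dual_value I i u h \<le> dual_value I i v g"
    using assms(2) vg by (simp add: dual_optimal_def)
  moreover have "primal_value I p i x \<le> dual_value I i u h"
    using assms by (intro weak_duality) (simp_all add: primal_optimal_def dual_optimal_def)
  ultimately show ?thesis using eq by simp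
qed

lemma primal_feasible_integral_binary:
  assumes feas: "primal_feasible I p i x" and nk: "(n, k) \<in> profitable I p i" and int: "x n k \<in> \<int>"
  shows "x n k \<in> {0, 1}"
proof -
  have "x n k \<le> (\<Sum>k | (n, k) \<in> profitable I p i. x n k)"
    using nk feas finite_profitable_resources
    by (intro member_le_sum) (auto simp: primal_feasible_def)
  also have "\<dots> \<le> 1"
    using feas subsetD[OF profitable_subset nk] by (simp add: primal_feasible_def)
  finally have "x n k \<le> 1" .
  moreover have "0 \<le> x n k" using feas nk by (auto simp: primal_feasible_def)
  moreover obtain a where "x n k = of_int a" using int by (rule Ints_cases)
  ultimately show ?thesis by auto
qed

lemma alg_step_exists: "\<exists>\<sigma>'. alg_step I i \<sigma> \<sigma>'"
proof -
  let ?P = "profitable I (price \<sigma>) i"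
  obtain x u h where x: "primal_feasible I (price \<sigma>) i x" "\<And>n k. x n k \<in> \<int>"
    and uh: "dual_feasible I (price \<sigma>) i u h"
    and eq: "primal_value I (price \<sigma>) i x = dual_value I i u h"
    by (rule integral_strong_duality[of "price \<sigma>" i]) blast
  have "finite {(n, k) \<in> ?P. x n k = 1}"
    using finite_profitable by (rule rev_finite_subset) auto
  then obtain ps where "set ps = {(n, k) \<in> ?P. x n k = 1}" "distinct ps"
    by (rule exE[OF finite_distinct_list]) blast
  moreover have "primal_optimal I (price \<sigma>) i x"
    using x(1) weak_duality[OF _ uh] eq by (simp add: primal_optimal_def)
  moreover have "dual_optimal I (price \<sigma>) i u h"
    using uh weak_duality[OF x(1)] eq by (simp add: dual_optimal_def)
  ultimately show ?thesis unfolding alg_step_def using x(2) by blast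
qed

lemma alg_output_exists: "\<exists>x. alg_output I x"
proof -
  have "\<exists>\<sigma>. alg_run I i \<sigma>" for i
    by (induction i) (use alg_step_exists in \<open>blast intro: alg_run.intros\<close>)+
  then show ?thesis by (auto simp: alg_output_def)
qed

end

section \<open>Loads and prices\<close>

definition covering :: "mkp_instance \<Rightarrow> nat \<Rightarrow> nat set \<Rightarrow> nat set" where
  "covering I k A = {n \<in> requests I. A \<subseteq> slots I n k}"

definition load :: "mkp_instance \<Rightarrow> (nat \<Rightarrow> nat \<Rightarrow> real) \<Rightarrow> nat \<Rightarrow> nat set \<Rightarrow> real" where
  "load I x k A = (\<Sum>n\<in>covering I k A. demand I n k * x n k)"

lemma load_zero: "load I (\<lambda>n k. 0) k A = 0"
  by (simp add: load_def)

lemma load_add: "load I (\<lambda>n k. x n k + y n k) k A = load I x k A + load I y k A"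
  by (simp add: load_def distrib_left sum.distrib)

lemma load_single:
  assumes "finite (requests I)" "m \<in> requests I"
  shows "load I (\<lambda>n k. of_bool ((n, k) = (m, j))) k {t} =
    of_bool (k = j \<and> t \<in> slots I m j) * demand I m j"
proof -
  have "load I (\<lambda>n k. of_bool ((n, k) = (m, j))) k {t} =
      (\<Sum>n\<in>covering I k {t}. if n = m then of_bool (k = j) * demand I m j else 0)"
    unfolding load_def by (rule sum.cong) auto
  also have "\<dots> = of_bool (k = j \<and> t \<in> slots I m j) * demand I m j"
    using assms by (auto simp: covering_def)
  finally show ?thesis .
qed

lemma load_insert:
  assumes "finite (requests I)" "m \<in> requests I" "(m, j) \<notin> X"
  shows "load I (\<lambda>n k. of_bool ((n, k) \<in> insert (m, j) X)) k {t} =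
    load I (\<lambda>n k. of_bool ((n, k) \<in> X)) k {t} + of_bool (k = j \<and> t \<in> slots I m j) * demand I m j"
proof -
  have "(\<lambda>n k. of_bool ((n, k) \<in> insert (m, j) X) :: real) =
      (\<lambda>n k. of_bool ((n, k) \<in> X) + of_bool ((n, k) = (m, j)))"
    using assms(3) by (auto simp: fun_eq_iff of_bool_def)
  then show ?thesis using load_single[OF assms(1,2)] by (simp only: load_add)
qed

definition growth :: "mkp_instance \<Rightarrow> nat \<Rightarrow> real \<Rightarrow> real" where
  "growth I k l = exp (l * gam I k / capacity I k)"

lemma growth_zero: "growth I k 0 = 1"
  by (simp add: growth_def)

lemma growth_add: "growth I k (l + l') = growth I k l * growth I k l'"
  by (simp add: growth_def distrib_right add_divide_distrib exp_add)

definition shifted_price :: "mkp_instance \<Rightarrow> (nat \<Rightarrow> nat \<Rightarrow> real) \<Rightarrow> nat \<Rightarrow> nat \<Rightarrow> real" where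
  "shifted_price I p k t = p k t + theta_min I k"

text \<open>Shifting the prices by \<open>theta_min\<close> turns the affine updates into multiplications.\<close>

lemma shifted_price_update:
  "shifted_price I (price_update I (m, j) p) k t =
    shifted_price I p k t * growth I k (of_bool (k = j \<and> t \<in> slots I m j) * demand I m j)"
  by (auto simp: shifted_price_def price_update_def beta_def mu_def growth_def algebra_simps)

lemma shifted_price_fold_update:
  assumes "finite (requests I)" "distinct ps" "fst ` set ps \<subseteq> requests I"
  shows "shifted_price I (fold (price_update I) ps p) k t =
    shifted_price I p k t * growth I k (load I (\<lambda>n k. of_bool ((n, k) \<in> set ps)) k {t})"
  using assms(2,3)
proof (induction ps arbitrary: p)
  case Nil
  show ?case by (simp add: load_zero growth_zero)
next
  case (Cons a ps)
  obtain m j where a: "a = (m, j)" by force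
  have "shifted_price I (fold (price_update I) (a # ps) p) k t =
      shifted_price I (price_update I (m, j) p) k t *
        growth I k (load I (\<lambda>n k. of_bool ((n, k) \<in> set ps)) k {t})"
    using Cons by (simp add: a)
  then show ?case
    using Cons.prems load_insert[OF assms(1), of m j "set ps" k t]
    by (simp add: a shifted_price_update growth_add mult_ac)
qed

section \<open>Runs of the algorithm\<close>

definition increment :: "alg_state \<Rightarrow> alg_state \<Rightarrow> nat \<Rightarrow> nat \<Rightarrow> real" where
  "increment \<sigma> \<sigma>' n k = sol \<sigma>' n k - sol \<sigma> n k"

lemma load_increment: "load I (sol \<sigma>') k A = load I (sol \<sigma>) k A + load I (increment \<sigma> \<sigma>') k A"
  by (simp add: load_add[symmetric] increment_def)

lemma alg_step_sol:
  assumes "alg_step I i \<sigma> \<sigma>'"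
  shows "sol \<sigma>' n k = sol \<sigma> n k \<or> sol \<sigma>' n k = 1 \<and> (n, k) \<in> profitable I (price \<sigma>) i"
  using assms by (auto simp: alg_step_def)

lemma run_sol_binary: "alg_run I i \<sigma> \<Longrightarrow> sol \<sigma> n k \<in> {0, 1}"
proof (induction rule: alg_run.induct)
  case (step i \<sigma> \<sigma>')
  then show ?case using alg_step_sol[OF step.hyps(2), of n k] by auto
qed (simp add: init_state_def)

lemma run_sol_nonneg: "alg_run I i \<sigma> \<Longrightarrow> 0 \<le> sol \<sigma> n k"
  using run_sol_binary[of I i \<sigma> n k] by auto

lemma run_sol_before_arrival: "alg_run I i \<sigma> \<Longrightarrow> i < arrival I n \<Longrightarrow> sol \<sigma> n k = 0"
proof (induction rule: alg_run.induct)
  case (step i \<sigma> \<sigma>')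
  then show ?case
    using alg_step_sol[OF step.hyps(2), of n k] by (auto simp: profitable_def batch_def)
qed (simp add: init_state_def)

lemma run_duals_before_arrival:
  assumes "alg_run I i \<sigma>"
  shows "i < arrival I n \<Longrightarrow> req_dual \<sigma> n = 0" and "i < j \<Longrightarrow> res_dual \<sigma> k j = 0"
  using assms by (induction rule: alg_run.induct) (auto simp: init_state_def alg_step_def batch_def)

context well_formed_instance
begin

context
  fixes i \<sigma> \<sigma>'
  assumes run: "alg_run I i \<sigma>" and step: "alg_step I (Suc i) \<sigma> \<sigma>'"
begin

lemma sol_batch_zero: "n \<in> batch I (Suc i) \<Longrightarrow> sol \<sigma> n k = 0"
  using run_sol_before_arrival[OF run] by (simp add: batch_def)

lemma increment_outside:
  assumes "(n, k) \<notin> profitable I (price \<sigma>) (Suc i)"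
  shows "increment \<sigma> \<sigma>' n k = 0"
  using alg_step_sol[OF step, of n k] assms by (simp add: increment_def)

lemma increment_binary: "increment \<sigma> \<sigma>' n k \<in> {0, 1}"
proof (cases "(n, k) \<in> profitable I (price \<sigma>) (Suc i)")
  case True
  then have "sol \<sigma> n k = 0" using profitable_subset sol_batch_zero by blast
  then show ?thesis using alg_step_sol[OF step, of n k] by (auto simp: increment_def)
qed (simp add: increment_outside)

lemma increment_nonneg: "0 \<le> increment \<sigma> \<sigma>' n k"
  using increment_binary[of n k] by auto

lemma increment_eq_sol: "n \<in> batch I (Suc i) \<Longrightarrow> increment \<sigma> \<sigma>' n k = sol \<sigma>' n k"
  by (simp add: increment_def sol_batch_zero)

lemma sol_step_unchanged: "n \<notin> batch I (Suc i) \<Longrightarrow> sol \<sigma>' n k = sol \<sigma> n k"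
  using alg_step_sol[OF step, of n k] profitable_subset by blast

lemma increment_primal_optimal: "primal_optimal I (price \<sigma>) (Suc i) (increment \<sigma> \<sigma>')"
proof -
  let ?P = "profitable I (price \<sigma>) (Suc i)"
  obtain x ps where x: "primal_optimal I (price \<sigma>) (Suc i) x" "\<forall>(n, k)\<in>?P. x n k \<in> \<int>"
    and ps: "set ps = {(n, k) \<in> ?P. x n k = 1}"
    and sol: "sol \<sigma>' = (\<lambda>n k. if (n, k) \<in> set ps then 1 else sol \<sigma> n k)"
    using step by (fastforce simp: alg_step_def)
  have "increment \<sigma> \<sigma>' n k = x n k" if nk: "(n, k) \<in> ?P" for n k
  proof -
    have "x n k \<in> {0, 1}"
      using x nk by (intro primal_feasible_integral_binary) (auto simp: primal_optimal_def)
    then show ?thesis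
      using nk subsetD[OF profitable_subset nk] sol_batch_zero by (auto simp: increment_def sol ps)
  qed
  then show ?thesis using x(1) by (subst primal_optimal_cong) auto
qed

lemma increment_request_le_1:
  assumes n: "n \<in> batch I (Suc i)"
  shows "(\<Sum>k\<in>resources I. increment \<sigma> \<sigma>' n k) \<le> 1"
proof -
  let ?P = "profitable I (price \<sigma>) (Suc i)"
  have "(\<Sum>k\<in>resources I. increment \<sigma> \<sigma>' n k) = (\<Sum>k | (n, k) \<in> ?P. increment \<sigma> \<sigma>' n k)"
    using finite_resources profitable_subset increment_outside
    by (intro sum.mono_neutral_right) auto
  then show ?thesis
    using n increment_primal_optimal by (simp add: primal_optimal_def primal_feasible_def)
qed

lemma increment_quota:
  assumes "k \<in> resources I"
  shows "(\<Sum>n\<in>batch I (Suc i). increment \<sigma> \<sigma>' n k) \<le> real (quota I k)"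
proof -
  let ?P = "profitable I (price \<sigma>) (Suc i)"
  have "(\<Sum>n\<in>batch I (Suc i). increment \<sigma> \<sigma>' n k) = (\<Sum>n | (n, k) \<in> ?P. increment \<sigma> \<sigma>' n k)"
    using finite_batch profitable_subset increment_outside
    by (intro sum.mono_neutral_right) auto
  then show ?thesis
    using assms increment_primal_optimal by (simp add: primal_optimal_def primal_feasible_def)
qed

lemma step_dual_optimal:
  "dual_optimal I (price \<sigma>) (Suc i) (req_dual \<sigma>') (\<lambda>k. res_dual \<sigma>' k (Suc i))"
proof -
  obtain u h where "dual_optimal I (price \<sigma>) (Suc i) u h"
    "req_dual \<sigma>' = (\<lambda>n. if n \<in> batch I (Suc i) then u n else req_dual \<sigma> n)"
    "res_dual \<sigma>' = (\<lambda>k j. if k \<in> resources I \<and> j = Suc i then h k else res_dual \<sigma> k j)"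
    using step by (auto simp: alg_step_def)
  then show ?thesis by (subst dual_optimal_cong) auto
qed

lemma step_dual_feasible:
  "dual_feasible I (price \<sigma>) (Suc i) (req_dual \<sigma>') (\<lambda>k. res_dual \<sigma>' k (Suc i))"
  using step_dual_optimal by (simp add: dual_optimal_def)

lemma req_dual_step_unchanged: "n \<notin> batch I (Suc i) \<Longrightarrow> req_dual \<sigma>' n = req_dual \<sigma> n"
  and res_dual_step_unchanged: "j \<noteq> Suc i \<Longrightarrow> res_dual \<sigma>' k j = res_dual \<sigma> k j"
  using step by (auto simp: alg_step_def)

lemma shifted_price_step:
  "shifted_price I (price \<sigma>') k t =
    shifted_price I (price \<sigma>) k t * growth I k (load I (increment \<sigma> \<sigma>') k {t})"
proof -
  obtain ps where ps: "distinct ps" "set ps \<subseteq> profitable I (price \<sigma>) (Suc i)"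
    and sol: "sol \<sigma>' = (\<lambda>n k. if (n, k) \<in> set ps then 1 else sol \<sigma> n k)"
    and price: "price \<sigma>' = fold (price_update I) ps (price \<sigma>)"
    using step by (fastforce simp: alg_step_def)
  have batch: "set ps \<subseteq> batch I (Suc i) \<times> resources I" using ps(2) profitable_subset by blast
  then have "increment \<sigma> \<sigma>' n k = of_bool ((n, k) \<in> set ps)" for n k
    using sol_batch_zero by (auto simp: increment_def sol)
  then have "increment \<sigma> \<sigma>' = (\<lambda>n k. of_bool ((n, k) \<in> set ps))" by blast
  moreover have "fst ` set ps \<subseteq> requests I" using batch batch_subset by fastforce
  ultimately show ?thesis
    using shifted_price_fold_update[OF finite_requests ps(1)] by (simp add: price)
qed

end

lemma run_request_le_1:
  assumes "alg_run I i \<sigma>"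
  shows "(\<Sum>k\<in>resources I. sol \<sigma> n k) \<le> 1"
  using assms
proof (induction rule: alg_run.induct)
  case (step i \<sigma> \<sigma>')
  note increment = increment_eq_sol[OF step.hyps] sol_step_unchanged[OF step.hyps]
  show ?case
    using increment_request_le_1[OF step.hyps, of n] step.IH
    by (cases "n \<in> batch I (Suc i)") (simp_all add: increment)
qed (simp add: init_state_def)

lemma run_quota:
  assumes "alg_run I i \<sigma>" and k: "k \<in> resources I"
  shows "(\<Sum>n\<in>batch I j. sol \<sigma> n k) \<le> real (quota I k)"
  using assms(1)
proof (induction rule: alg_run.induct)
  case (step i \<sigma> \<sigma>')
  show ?case
  proof (cases "j = Suc i")
    case True
    then show ?thesis
      using increment_quota[OF step.hyps k] by (simp add: increment_eq_sol[OF step.hyps])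
  next
    case False
    then have "(\<Sum>n\<in>batch I j. sol \<sigma>' n k) = (\<Sum>n\<in>batch I j. sol \<sigma> n k)"
      by (intro sum.cong sol_step_unchanged[OF step.hyps]) (auto simp: batch_def)
    then show ?thesis using step.IH by simp
  qed
qed (simp add: init_state_def)

lemma run_shifted_price:
  assumes "alg_run I i \<sigma>"
  shows "shifted_price I (price \<sigma>) k t = theta_min I k * growth I k (load I (sol \<sigma>) k {t})"
  using assms
proof (induction rule: alg_run.induct)
  case init
  show ?case by (simp add: init_state_def shifted_price_def load_zero growth_zero)
next
  case (step i \<sigma> \<sigma>')
  then show ?case
    by (simp add: shifted_price_step load_increment[of I \<sigma>' k _ \<sigma>] growth_add)
qed

end

locale admissible_instance =
  fixes I :: mkp_instance
  assumes admissible: "admissible I"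
begin

sublocale well_formed_instance
  using admissible by unfold_locales (simp add: admissible_def)

lemma theta_min_pos: "k \<in> resources I \<Longrightarrow> 0 < theta_min I k"
  and theta_bounds: "n \<in> requests I \<Longrightarrow> k \<in> resources I \<Longrightarrow> 0 < reward I n k \<Longrightarrow>
    theta I n k \<in> {theta_min I k..theta_max I k}"
  and theta_ratio_ge_1: "k \<in> resources I \<Longrightarrow> 1 \<le> theta_ratio I k"
  using admissible by (auto simp: admissible_def density_assumption_def theta_ratio_def)

lemma dur_min_pos: "k \<in> resources I \<Longrightarrow> 0 < dur_min I k"
  and duration_bounds: "n \<in> requests I \<Longrightarrow> k \<in> resources I \<Longrightarrow>
    real (duration I n k) \<in> {dur_min I k..dur_max I k}"
  and dur_ratio_ge_1: "k \<in> resources I \<Longrightarrow> 1 \<le> dur_ratio I k"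
  using admissible by (auto simp: admissible_def duration_assumption_def dur_ratio_def)

lemma ratio_product_nonneg: "k \<in> resources I \<Longrightarrow> 0 \<le> theta_ratio I k * dur_ratio I k"
  using theta_ratio_ge_1[of k] dur_ratio_ge_1[of k] by simp

lemma gam_pos: "k \<in> resources I \<Longrightarrow> 0 < gam I k"
  using ratio_product_nonneg[of k] by (simp add: gam_def mult.assoc)

lemma finite_covering: "finite (covering I k A)"
  using finite_requests by (simp add: covering_def)

lemma demand_mult_nonneg:
  "k \<in> resources I \<Longrightarrow> n \<in> covering I k A \<Longrightarrow> 0 \<le> a \<Longrightarrow> 0 \<le> demand I n k * a"
  using demand_pos[of n k] by (simp add: covering_def)

lemma load_nonneg:
  assumes "k \<in> resources I" "\<And>n. 0 \<le> x n k"
  shows "0 \<le> load I x k A"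
  unfolding load_def using assms by (intro sum_nonneg demand_mult_nonneg)

lemma load_antimono:
  assumes "k \<in> resources I" "\<And>n. 0 \<le> x n k" "A \<subseteq> B"
  shows "load I x k B \<le> load I x k A"
  unfolding load_def using assms finite_covering
  by (intro sum_mono2 demand_mult_nonneg) (auto simp: covering_def)

lemma load_le_add:
  assumes "k \<in> resources I" "\<And>n. 0 \<le> x n k" "covering I k A \<subseteq> covering I k B \<union> covering I k C"
  shows "load I x k A \<le> load I x k B + load I x k C"
proof -
  let ?d = "\<lambda>n. demand I n k * x n k"
  have nonneg: "0 \<le> ?d n" if "n \<in> covering I k D" for n D
    using demand_mult_nonneg[OF assms(1) that] assms(2) .
  have "load I x k A \<le> sum ?d (covering I k B \<union> covering I k C)"
    unfolding load_def using assms(3) finite_covering nonneg by (intro sum_mono2) auto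
  also have "\<dots> \<le> load I x k B + load I x k C"
    unfolding load_def using finite_covering nonneg
    by (subst sum_Un) (auto intro!: sum_nonneg)
  finally show ?thesis .
qed

lemma growth_mono: "k \<in> resources I \<Longrightarrow> l \<le> l' \<Longrightarrow> growth I k l \<le> growth I k l'"
  using gam_pos[of k] capacity_pos[of k] by (simp add: growth_def divide_right_mono)

lemma growth_ge_1: "k \<in> resources I \<Longrightarrow> 0 \<le> l \<Longrightarrow> 1 \<le> growth I k l"
  using growth_mono[of k 0 l] by (simp add: growth_zero)

lemma run_price_ge:
  assumes run: "alg_run I i \<sigma>" and k: "k \<in> resources I" and t: "t \<in> A"
  shows "theta_min I k * (growth I k (load I (sol \<sigma>) k A) - 1) \<le> price \<sigma> k t"
proof -
  have "load I (sol \<sigma>) k A \<le> load I (sol \<sigma>) k {t}"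
    using k run_sol_nonneg[OF run] t by (intro load_antimono) auto
  then have "theta_min I k * growth I k (load I (sol \<sigma>) k A) \<le> shifted_price I (price \<sigma>) k t"
    unfolding run_shifted_price[OF run] using growth_mono[OF k] theta_min_pos[OF k] by simp
  then show ?thesis by (simp add: shifted_price_def algebra_simps)
qed

lemma run_price_nonneg:
  assumes run: "alg_run I i \<sigma>" and k: "k \<in> resources I"
  shows "0 \<le> price \<sigma> k t"
proof -
  have "1 \<le> growth I k (load I (sol \<sigma>) k {t})"
    using k run_sol_nonneg[OF run] by (intro growth_ge_1 load_nonneg)
  then have "0 \<le> theta_min I k * (growth I k (load I (sol \<sigma>) k {t}) - 1)"
    using theta_min_pos[OF k] by simp
  also have "\<dots> \<le> price \<sigma> k t" using run_price_ge[OF run k] by simp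
  finally show ?thesis .
qed

lemma run_shifted_price_nonneg:
  "alg_run I i \<sigma> \<Longrightarrow> k \<in> resources I \<Longrightarrow> 0 \<le> shifted_price I (price \<sigma>) k t"
  using run_price_nonneg[of i \<sigma> k t] theta_min_pos[of k] by (simp add: shifted_price_def)

lemma price_step_mono:
  assumes run: "alg_run I i \<sigma>" and step: "alg_step I (Suc i) \<sigma> \<sigma>'" and k: "k \<in> resources I"
  shows "price \<sigma> k t \<le> price \<sigma>' k t"
proof -
  have "1 \<le> growth I k (load I (increment \<sigma> \<sigma>') k {t})"
    using k increment_nonneg[OF run step] by (intro growth_ge_1 load_nonneg)
  then have "shifted_price I (price \<sigma>) k t \<le> shifted_price I (price \<sigma>') k t"
    unfolding shifted_price_step[OF run step]
    using run_shifted_price_nonneg[OF run k] mult_left_mono by fastforce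
  then show ?thesis by (simp add: shifted_price_def)
qed

lemma run_cost_nonneg:
  assumes "alg_run I i \<sigma>" "n \<in> requests I" "k \<in> resources I"
  shows "0 \<le> demand I n k * (\<Sum>t\<in>slots I n k. price \<sigma> k t)"
  using demand_pos[OF assms(2,3)] run_price_nonneg[OF assms(1,3)] by (simp add: sum_nonneg)

lemma reward_eq_theta:
  assumes "n \<in> requests I" "k \<in> resources I"
  shows "reward I n k = demand I n k * (theta I n k * real (duration I n k))"
  using demand_pos[OF assms] duration_ge_1[OF assms] by (simp add: theta_def)

end

section \<open>Feasibility\<close>

lemma window_in_slots:
  assumes "t \<in> slots I n k" "2 * m \<le> duration I n k + 1"
  shows "{t..<t + m} \<subseteq> slots I n k \<or> m \<le> t + 1 \<and> {t + 1 - m..<t + 1} \<subseteq> slots I n k"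
proof -
  have "t + m \<le> start I n k + duration I n k \<or> start I n k + m \<le> t + 1"
    using assms by (auto simp: slots_def)
  then show ?thesis using assms(1) by (auto simp: slots_def)
qed

definition doubling_load :: "mkp_instance \<Rightarrow> nat \<Rightarrow> real" where
  "doubling_load I k = capacity I k * ln 2 / gam I k"

context admissible_instance
begin

lemma growth_doubling_load: "k \<in> resources I \<Longrightarrow> growth I k (doubling_load I k) = 2"
  using capacity_pos[of k] gam_pos[of k] by (simp add: growth_def doubling_load_def)

lemma growth_half_capacity:
  assumes k: "k \<in> resources I"
  shows "growth I k (capacity I k / 2) = 2 + 4 * (theta_ratio I k * dur_ratio I k)"
  using capacity_pos[OF k] ratio_product_nonneg[OF k]
  by (simp add: growth_def gam_def mult.assoc)

lemma growth_nearly_half_capacity: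
  assumes k: "k \<in> resources I"
  shows "growth I k (capacity I k / 2 - doubling_load I k) =
    1 + 2 * (theta_ratio I k * dur_ratio I k)"
  using growth_add[of I k "capacity I k / 2 - doubling_load I k" "doubling_load I k"]
  by (simp add: growth_half_capacity[OF k] growth_doubling_load[OF k])

lemma reward_le:
  assumes n: "n \<in> requests I" and k: "k \<in> resources I"
  shows "reward I n k \<le> demand I n k * (theta_max I k * dur_max I k)"
proof -
  have bounds: "0 \<le> theta_max I k" "real (duration I n k) \<le> dur_max I k"
    using admissible n k
    by (auto simp: admissible_def density_assumption_def duration_assumption_def intro: order.trans)
  have "theta I n k \<le> theta_max I k"
  proof (cases "reward I n k = 0")
    case False
    then show ?thesis using theta_bounds[OF n k] reward_nonneg[OF n k] by simp
  qed (simp add: theta_def bounds)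
  then show ?thesis
    unfolding reward_eq_theta[OF n k] using bounds demand_pos[OF n k]
    by (intro mult_left_mono mult_mono) auto
qed

lemma run_price_ge_if_loaded:
  assumes run: "alg_run I i \<sigma>" and k: "k \<in> resources I" and t: "t \<in> A"
    and loaded: "capacity I k / 2 - doubling_load I k \<le> load I (sol \<sigma>) k A"
  shows "2 * (theta_min I k * (theta_ratio I k * dur_ratio I k)) \<le> price \<sigma> k t"
proof -
  have "2 * (theta_ratio I k * dur_ratio I k) \<le> growth I k (load I (sol \<sigma>) k A) - 1"
    using growth_mono[OF k loaded] growth_nearly_half_capacity[OF k] by simp
  then have "theta_min I k * (2 * (theta_ratio I k * dur_ratio I k)) \<le>
      theta_min I k * (growth I k (load I (sol \<sigma>) k A) - 1)"
    using theta_min_pos[OF k] by simp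
  then show ?thesis using run_price_ge[OF run k t] by simp
qed

lemma not_profitable_if_loaded:
  assumes run: "alg_run I i \<sigma>" and n: "n \<in> requests I" and k: "k \<in> resources I"
    and A: "A \<subseteq> slots I n k" "dur_min I k / 2 \<le> real (card A)"
    and loaded: "capacity I k / 2 - doubling_load I k \<le> load I (sol \<sigma>) k A"
  shows "reduced_reward I (price \<sigma>) n k \<le> 0"
proof -
  define b where "b = 2 * (theta_min I k * (theta_ratio I k * dur_ratio I k))"
  have "theta_max I k * dur_max I k = dur_min I k / 2 * b"
    using theta_min_pos[OF k] dur_min_pos[OF k] by (simp add: b_def theta_ratio_def dur_ratio_def)
  also have "\<dots> \<le> real (card A) * b"
    using A(2) theta_min_pos[OF k] ratio_product_nonneg[OF k]
    by (intro mult_right_mono) (simp_all add: b_def)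
  also have "\<dots> \<le> (\<Sum>t\<in>A. price \<sigma> k t)"
    using run_price_ge_if_loaded[OF run k _ loaded] by (intro sum_bounded_below) (simp add: b_def)
  also have "\<dots> \<le> (\<Sum>t\<in>slots I n k. price \<sigma> k t)"
    using A(1) run_price_nonneg[OF run k] by (intro sum_mono2) (auto simp: slots_def)
  finally have "demand I n k * (theta_max I k * dur_max I k) \<le>
      demand I n k * (\<Sum>t\<in>slots I n k. price \<sigma> k t)"
    using demand_pos[OF n k] by simp
  then show ?thesis using reward_le[OF n k] by (simp add: reduced_reward_def)
qed

end

locale small_demand_instance = admissible_instance +
  assumes small_demands: "small_demands I"
begin

lemma quota_mult_demand_le:
  assumes n: "n \<in> requests I" and k: "k \<in> resources I"
  shows "real (quota I k) * demand I n k \<le> doubling_load I k"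
proof -
  have "demand I n k \<le> demand_bound I k"
    using admissible n k by (simp add: admissible_def demand_assumption_def)
  also have "\<dots> \<le> doubling_load I k / real (quota I k)"
    using small_demands k by (simp add: small_demands_def doubling_load_def mult.commute)
  finally show ?thesis using quota_pos[OF k] by (simp add: field_simps)
qed

lemma increment_load_le:
  assumes run: "alg_run I i \<sigma>" and step: "alg_step I (Suc i) \<sigma> \<sigma>'" and k: "k \<in> resources I"
  shows "load I (increment \<sigma> \<sigma>') k A \<le> doubling_load I k"
proof -
  let ?y = "increment \<sigma> \<sigma>'" and ?B = "batch I (Suc i)" and ?q = "real (quota I k)"
  have outside: "?y n k = 0" if "n \<notin> ?B" for n
    using increment_outside[OF run step] that profitable_subset by blast
  have "load I ?y k A = (\<Sum>n\<in>covering I k A \<inter> ?B. demand I n k * ?y n k)"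
    unfolding load_def using finite_covering outside by (intro sum.mono_neutral_right) auto
  also have "?q * \<dots> \<le> (\<Sum>n\<in>covering I k A \<inter> ?B. doubling_load I k * ?y n k)"
    unfolding sum_distrib_left mult.assoc[symmetric]
    using k increment_nonneg[OF run step]
    by (intro sum_mono mult_right_mono quota_mult_demand_le) (simp_all add: covering_def)
  also have "\<dots> \<le> (\<Sum>n\<in>?B. doubling_load I k * ?y n k)"
    using finite_batch increment_nonneg[OF run step] capacity_pos[OF k] gam_pos[OF k]
    by (intro sum_mono2) (auto simp: doubling_load_def)
  also have "\<dots> \<le> doubling_load I k * ?q"
    unfolding sum_distrib_left[symmetric]
    using increment_quota[OF run step k] capacity_pos[OF k] gam_pos[OF k]
    by (intro mult_left_mono) (auto simp: doubling_load_def)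
  finally show ?thesis using quota_pos[OF k] by (simp add: mult.commute)
qed

text \<open>
  A request covering \<open>A\<close> is accepted only while the load falls short of half of the capacity by more
  than the doubling load, and a batch adds at most the doubling load.
\<close>

lemma run_load_le_half_capacity:
  assumes "alg_run I i \<sigma>" and k: "k \<in> resources I" and A: "dur_min I k / 2 \<le> real (card A)"
  shows "load I (sol \<sigma>) k A \<le> capacity I k / 2"
  using assms(1)
proof (induction rule: alg_run.induct)
  case init
  show ?case using capacity_pos[OF k] by (simp add: init_state_def load_zero)
next
  case (step i \<sigma> \<sigma>')
  let ?y = "increment \<sigma> \<sigma>'"
  show ?case
  proof (cases "\<exists>n\<in>covering I k A. ?y n k \<noteq> 0")
    case True
    then obtain n where n: "n \<in> requests I" "A \<subseteq> slots I n k" and "?y n k \<noteq> 0"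
      by (auto simp: covering_def)
    then have "0 < reduced_reward I (price \<sigma>) n k"
      using increment_outside[OF step.hyps, of n k] by (auto simp: profitable_def)
    then have "load I (sol \<sigma>) k A < capacity I k / 2 - doubling_load I k"
      using not_profitable_if_loaded[OF step.hyps(1) n(1) k n(2) A] by linarith
    then show ?thesis
      using increment_load_le[OF step.hyps k, of A] load_increment[of I \<sigma>' k A \<sigma>] by linarith
  next
    case False
    then have "load I ?y k A = 0" by (simp add: load_def)
    then show ?thesis using load_increment[of I \<sigma>' k A \<sigma>] step.IH by simp
  qed
qed

lemma run_load_le_capacity:
  assumes run: "alg_run I i \<sigma>" and k: "k \<in> resources I"
  shows "load I (sol \<sigma>) k {t} \<le> capacity I k"
proof -
  define m where "m = nat \<lceil>dur_min I k / 2\<rceil>"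
  have m: "dur_min I k / 2 \<le> real m" "real m < dur_min I k / 2 + 1"
    using dur_min_pos[OF k] unfolding m_def by linarith+
  define R where "R = {t..<t + m}"
  define L where "L = (if m \<le> t + 1 then {t + 1 - m..<t + 1} else R)"
  have "2 * m \<le> duration I n k + 1" if "n \<in> requests I" for n
    using duration_bounds[OF that k] m(2) by auto
  then have "covering I k {t} \<subseteq> covering I k R \<union> covering I k L"
    using window_in_slots[of t I _ k m] by (auto simp: covering_def R_def L_def)
  then have "load I (sol \<sigma>) k {t} \<le> load I (sol \<sigma>) k R + load I (sol \<sigma>) k L"
    using k run_sol_nonneg[OF run] by (intro load_le_add)
  also have "\<dots> \<le> capacity I k / 2 + capacity I k / 2"
    using run k m(1) by (intro add_mono run_load_le_half_capacity) (simp_all add: R_def L_def)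
  finally show ?thesis by simp
qed

theorem alg_output_feasible:
  assumes "alg_output I x"
  shows "feasible I x"
proof -
  obtain \<sigma> where run: "alg_run I (horizon I) \<sigma>" and x: "x = sol \<sigma>"
    using assms by (auto simp: alg_output_def)
  have "(\<Sum>n | n \<in> requests I \<and> t \<in> slots I n k. demand I n k * x n k) \<le> capacity I k"
    if "k \<in> resources I" for k t
    using run_load_le_capacity[OF run that, of t] by (simp add: x load_def covering_def)
  then show ?thesis
    using run_sol_binary[OF run] run_request_le_1[OF run] run_quota[OF run]
    by (simp add: feasible_def x)
qed

end

section \<open>The dual of the offline linear program\<close>

definition offline_dual_feasible ::
    "mkp_instance \<Rightarrow> (nat \<Rightarrow> real) \<Rightarrow> (nat \<Rightarrow> nat \<Rightarrow> real) \<Rightarrow> (nat \<Rightarrow> nat \<Rightarrow> real) \<Rightarrow> bool" where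
  "offline_dual_feasible I u h p \<longleftrightarrow>
     (\<forall>n\<in>requests I. \<forall>k\<in>resources I.
        reward I n k \<le> u n + h k (arrival I n) + demand I n k * (\<Sum>t\<in>slots I n k. p k t)) \<and>
     (\<forall>n\<in>requests I. 0 \<le> u n) \<and>
     (\<forall>k\<in>resources I. \<forall>t\<in>time_slots I. 0 \<le> h k t \<and> 0 \<le> p k t)"

definition offline_dual_value ::
    "mkp_instance \<Rightarrow> (nat \<Rightarrow> real) \<Rightarrow> (nat \<Rightarrow> nat \<Rightarrow> real) \<Rightarrow> (nat \<Rightarrow> nat \<Rightarrow> real) \<Rightarrow> real" where
  "offline_dual_value I u h p = (\<Sum>n\<in>requests I. u n) +
    (\<Sum>k\<in>resources I. real (quota I k) * (\<Sum>j\<in>time_slots I. h k j)) +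
    (\<Sum>k\<in>resources I. capacity I k * (\<Sum>t\<in>time_slots I. p k t))"

definition resource_value :: "mkp_instance \<Rightarrow> (nat \<Rightarrow> nat \<Rightarrow> real) \<Rightarrow> nat \<Rightarrow> real" where
  "resource_value I x k = (\<Sum>n\<in>requests I. reward I n k * x n k)"

lemma solution_value_conv_resource_value:
  "solution_value I x = (\<Sum>k\<in>resources I. resource_value I x k)"
  unfolding solution_value_def resource_value_def by (rule sum.swap)

lemma finite_time_slots: "finite (time_slots I)"
  by (simp add: time_slots_def)

context well_formed_instance
begin

lemma sum_mult_load:
  assumes "k \<in> resources I"
  shows "(\<Sum>t\<in>time_slots I. g t * load I x k {t}) =
    (\<Sum>n\<in>requests I. demand I n k * (\<Sum>t\<in>slots I n k. g t) * x n k)"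
proof -
  let ?g = "\<lambda>n t. g t * (demand I n k * x n k)"
  have slots: "{t \<in> time_slots I. t \<in> slots I n k} = slots I n k" if "n \<in> requests I" for n
    using slots_subset[OF that assms] by auto
  have "(\<Sum>t\<in>time_slots I. g t * load I x k {t}) =
      (\<Sum>t\<in>time_slots I. \<Sum>n | n \<in> requests I \<and> t \<in> slots I n k. ?g n t)"
    by (simp add: load_def covering_def sum_distrib_left)
  also have "\<dots> = (\<Sum>n\<in>requests I. \<Sum>t | t \<in> time_slots I \<and> t \<in> slots I n k. ?g n t)"
    using finite_time_slots finite_requests by (rule sum.swap_restrict)
  also have "\<dots> = (\<Sum>n\<in>requests I. demand I n k * (\<Sum>t\<in>slots I n k. g t) * x n k)"
    by (intro sum.cong) (simp_all add: slots sum_distrib_right[symmetric] mult_ac)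
  finally show ?thesis .
qed

lemma sum_requests_by_batch:
  fixes y :: "nat \<Rightarrow> real"
  shows "(\<Sum>n\<in>requests I. g (arrival I n) * y n) = (\<Sum>j\<in>time_slots I. g j * (\<Sum>n\<in>batch I j. y n))"
proof -
  have "(\<Sum>n\<in>requests I. g (arrival I n) * y n) =
      (\<Sum>j\<in>time_slots I. \<Sum>n | n \<in> requests I \<and> arrival I n = j. g (arrival I n) * y n)"
    using finite_requests finite_time_slots arrival_slot by (intro sum.group[symmetric]) auto
  then show ?thesis by (simp add: batch_def sum_distrib_left)
qed

lemma feasible_capacity_cost_le:
  assumes x: "feasible I x" and k: "k \<in> resources I" and p: "\<And>t. t \<in> time_slots I \<Longrightarrow> 0 \<le> p t"
  shows "(\<Sum>n\<in>requests I. demand I n k * (\<Sum>t\<in>slots I n k. p t) * x n k) \<le>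
    capacity I k * (\<Sum>t\<in>time_slots I. p t)"
proof -
  have "load I x k {t} \<le> capacity I k" if "t \<in> time_slots I" for t
    using x k that by (simp add: feasible_def load_def covering_def)
  then have "(\<Sum>t\<in>time_slots I. p t * load I x k {t}) \<le> (\<Sum>t\<in>time_slots I. p t * capacity I k)"
    using p by (intro sum_mono mult_left_mono)
  then show ?thesis
    unfolding sum_mult_load[OF k] sum_distrib_right[symmetric] by (simp only: mult.commute)
qed

lemma feasible_quota_cost_le:
  assumes x: "feasible I x" and k: "k \<in> resources I" and h: "\<And>j. j \<in> time_slots I \<Longrightarrow> 0 \<le> h j"
  shows "(\<Sum>n\<in>requests I. h (arrival I n) * x n k) \<le> real (quota I k) * (\<Sum>j\<in>time_slots I. h j)"
proof -
  have "(\<Sum>j\<in>time_slots I. h j * (\<Sum>n\<in>batch I j. x n k)) \<le> (\<Sum>j\<in>time_slots I. h j * real (quota I k))"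
    using x k h by (intro sum_mono mult_left_mono) (auto simp: feasible_def)
  then show ?thesis
    unfolding sum_requests_by_batch[of h "\<lambda>n. x n k"] sum_distrib_right[symmetric]
    by (simp only: mult.commute)
qed

lemma offline_weak_duality:
  assumes x: "feasible I x" and dual: "offline_dual_feasible I u h p"
  shows "solution_value I x \<le> offline_dual_value I u h p"
proof -
  let ?N = "requests I" and ?K = "resources I"
  let ?c = "\<lambda>n k. demand I n k * (\<Sum>t\<in>slots I n k. p k t)"
  have "0 \<le> x n k" if "n \<in> ?N" "k \<in> ?K" for n k
    using x that by (fastforce simp: feasible_def)
  then have "solution_value I x \<le> (\<Sum>n\<in>?N. \<Sum>k\<in>?K. (u n + h k (arrival I n) + ?c n k) * x n k)"
    unfolding solution_value_def using dual
    by (intro sum_mono mult_right_mono) (auto simp: offline_dual_feasible_def)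
  also have "\<dots> = (\<Sum>n\<in>?N. u n * (\<Sum>k\<in>?K. x n k)) +
      (\<Sum>k\<in>?K. \<Sum>n\<in>?N. h k (arrival I n) * x n k) + (\<Sum>k\<in>?K. \<Sum>n\<in>?N. ?c n k * x n k)"
    by (simp only: distrib_right sum.distrib sum_distrib_left sum.swap[of _ ?N ?K])
  also have "\<dots> \<le> offline_dual_value I u h p"
    unfolding offline_dual_value_def
  proof (intro add_mono sum_mono)
    show "u n * (\<Sum>k\<in>?K. x n k) \<le> u n" if "n \<in> ?N" for n
      using x dual that by (intro mult_left_le) (auto simp: feasible_def offline_dual_feasible_def)
  next
    fix k assume k: "k \<in> ?K"
    show "(\<Sum>n\<in>?N. h k (arrival I n) * x n k) \<le> real (quota I k) * (\<Sum>j\<in>time_slots I. h k j)"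
      using x k dual by (intro feasible_quota_cost_le) (auto simp: offline_dual_feasible_def)
    show "(\<Sum>n\<in>?N. ?c n k * x n k) \<le> capacity I k * (\<Sum>t\<in>time_slots I. p k t)"
      using x k dual by (intro feasible_capacity_cost_le) (auto simp: offline_dual_feasible_def)
  qed
  finally show ?thesis .
qed

lemma finite_feasible_values: "finite (solution_value I ` {x. feasible I x})"
proof (rule finite_subset)
  let ?U = "requests I \<times> resources I"
  let ?v = "\<lambda>S. solution_value I (\<lambda>n k. of_bool ((n, k) \<in> S))"
  show "solution_value I ` {x. feasible I x} \<subseteq> ?v ` Pow ?U"
  proof clarify
    fix x assume x: "feasible I x"
    define S where "S = {(n, k) \<in> ?U. x n k = 1}"
    have "x n k = of_bool ((n, k) \<in> S)" if "n \<in> requests I" "k \<in> resources I" for n k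
      using x that by (auto simp: S_def feasible_def)
    then have "solution_value I x = ?v S"
      unfolding solution_value_def by (intro sum.cong) simp_all
    moreover have "S \<in> Pow ?U" by (auto simp: S_def)
    ultimately show "solution_value I x \<in> ?v ` Pow ?U" by blast
  qed
  show "finite (?v ` Pow ?U)" using finite_requests finite_resources by simp
qed

lemma dual_feasible_ge_reduced_reward:
  assumes "dual_feasible I p i u h" "n \<in> batch I i" "k \<in> resources I"
  shows "reduced_reward I p n k \<le> u n + h k"
proof (cases "(n, k) \<in> profitable I p i")
  case False
  then have "reduced_reward I p n k \<le> 0" using assms(2,3) by (simp add: profitable_def)
  also have "\<dots> \<le> u n + h k" using assms by (simp add: dual_feasible_def)
  finally show ?thesis .
qed (use assms(1) in \<open>auto simp: dual_feasible_def\<close>)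

lemma run_duals_nonneg:
  assumes "alg_run I i \<sigma>"
  shows "n \<in> requests I \<Longrightarrow> 0 \<le> req_dual \<sigma> n" and "k \<in> resources I \<Longrightarrow> 0 \<le> res_dual \<sigma> k j"
  using assms
proof (induction rule: alg_run.induct)
  case (step i \<sigma> \<sigma>')
  note dual = step_dual_feasible[OF step.hyps] and unchanged =
    req_dual_step_unchanged[OF step.hyps] res_dual_step_unchanged[OF step.hyps]
  {
    case 1
    then show ?case
      using dual unchanged(1) step.IH(1)
      by (cases "n \<in> batch I (Suc i)") (simp_all add: dual_feasible_def)
  next
    case 2
    then show ?case
      using dual unchanged(2) step.IH(2) by (cases "j = Suc i") (simp_all add: dual_feasible_def)
  }
qed (simp_all add: init_state_def)

end

section \<open>Competitiveness\<close>

lemma exp_le_one_plus_double: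
  fixes a :: real
  assumes "0 \<le> a" "a \<le> 1"
  shows "exp a \<le> 1 + 2 * a"
proof -
  have "exp a \<le> 1 + a + a\<^sup>2" using assms by (rule exp_bound)
  also have "a\<^sup>2 \<le> a" using assms by (simp add: power2_eq_square mult_left_le)
  finally show ?thesis by simp
qed

context admissible_instance
begin

lemma gam_le:
  assumes k: "k \<in> resources I"
  shows "gam I k \<le> 2 * ln (2 + 4 * (theta_ratio_max I * dur_ratio_max I))"
proof -
  have "theta_ratio I k \<le> theta_ratio_max I" "dur_ratio I k \<le> dur_ratio_max I"
    unfolding theta_ratio_max_def dur_ratio_max_def using finite_resources k by (auto intro: Max_ge)
  then have "theta_ratio I k * dur_ratio I k \<le> theta_ratio_max I * dur_ratio_max I"
    using theta_ratio_ge_1[OF k] dur_ratio_ge_1[OF k] by (intro mult_mono) auto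
  then show ?thesis using ratio_product_nonneg[OF k] by (simp add: gam_def mult.assoc)
qed

lemma run_dual_covers:
  assumes "alg_run I i \<sigma>" and n: "n \<in> requests I" and k: "k \<in> resources I"
    and "arrival I n \<le> i"
  shows "reward I n k \<le>
    req_dual \<sigma> n + res_dual \<sigma> k (arrival I n) + demand I n k * (\<Sum>t\<in>slots I n k. price \<sigma> k t)"
  using assms(1,4)
proof (induction rule: alg_run.induct)
  case init
  then show ?case using arrival_slot[OF n] by (simp add: time_slots_def)
next
  case (step i \<sigma> \<sigma>')
  let ?c = "\<lambda>\<sigma>. demand I n k * (\<Sum>t\<in>slots I n k. price \<sigma> k t)"
  have "?c \<sigma> \<le> ?c \<sigma>'"
    using price_step_mono[OF step.hyps k] demand_pos[OF n k]
    by (intro mult_left_mono sum_mono) auto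
  moreover have "reward I n k \<le> req_dual \<sigma>' n + res_dual \<sigma>' k (arrival I n) + ?c \<sigma>"
  proof (cases "n \<in> batch I (Suc i)")
    case True
    then show ?thesis
      using dual_feasible_ge_reduced_reward[OF step_dual_feasible[OF step.hyps] True k]
      by (simp add: reduced_reward_def batch_def)
  next
    case False
    then have "arrival I n \<noteq> Suc i" using n by (simp add: batch_def)
    then show ?thesis
      using step.IH step.prems False
      by (simp add: req_dual_step_unchanged[OF step.hyps] res_dual_step_unchanged[OF step.hyps])
  qed
  ultimately show ?case by linarith
qed

lemma run_offline_dual_feasible:
  assumes run: "alg_run I (horizon I) \<sigma>"
  shows "offline_dual_feasible I (req_dual \<sigma>) (res_dual \<sigma>) (price \<sigma>)"
proof -
  have "arrival I n \<le> horizon I" if "n \<in> requests I" for n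
    using arrival_slot[OF that] by (simp add: time_slots_def)
  then show ?thesis
    using run_dual_covers[OF run] run_duals_nonneg[OF run] run_price_nonneg[OF run]
    by (simp add: offline_dual_feasible_def)
qed

lemma profitable_shifted_cost_le:
  assumes run: "alg_run I i \<sigma>" and nk: "(n, k) \<in> profitable I (price \<sigma>) j"
  shows "demand I n k * (\<Sum>t\<in>slots I n k. shifted_price I (price \<sigma>) k t) \<le> 2 * reward I n k"
proof -
  have n: "n \<in> requests I" and k: "k \<in> resources I"
    and less: "demand I n k * (\<Sum>t\<in>slots I n k. price \<sigma> k t) < reward I n k"
    using nk by (auto simp: profitable_def batch_def reduced_reward_def)
  have "0 < reward I n k"
    using less run_cost_nonneg[OF run n k] by linarith
  then have "theta_min I k \<le> theta I n k" using theta_bounds[OF n k] by simp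
  then have "demand I n k * (theta_min I k * real (duration I n k)) \<le> reward I n k"
    unfolding reward_eq_theta[OF n k] using demand_pos[OF n k]
    by (intro mult_left_mono mult_right_mono) auto
  moreover have "(\<Sum>t\<in>slots I n k. shifted_price I (price \<sigma>) k t) =
      (\<Sum>t\<in>slots I n k. price \<sigma> k t) + theta_min I k * real (duration I n k)"
    by (simp add: shifted_price_def sum.distrib slots_def)
  ultimately show ?thesis using less by (simp add: distrib_left)
qed

context
  fixes i \<sigma> \<sigma>'
  assumes run: "alg_run I i \<sigma>" and step: "alg_step I (Suc i) \<sigma> \<sigma>'"
begin

lemma sum_shifted_price_load_le:
  assumes k: "k \<in> resources I"
  shows "(\<Sum>t\<in>time_slots I. shifted_price I (price \<sigma>) k t * load I (increment \<sigma> \<sigma>') k {t}) \<le>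
    2 * resource_value I (increment \<sigma> \<sigma>') k"
  unfolding sum_mult_load[OF k] resource_value_def sum_distrib_left[of 2]
proof (rule sum_mono)
  fix n assume "n \<in> requests I"
  let ?c = "demand I n k * (\<Sum>t\<in>slots I n k. shifted_price I (price \<sigma>) k t)"
  show "?c * increment \<sigma> \<sigma>' n k \<le> 2 * (reward I n k * increment \<sigma> \<sigma>' n k)"
  proof (cases "(n, k) \<in> profitable I (price \<sigma>) (Suc i)")
    case True
    then show ?thesis
      using mult_right_mono[OF profitable_shifted_cost_le[OF run True] increment_nonneg[OF run step]]
      by (simp add: mult.assoc)
  qed (simp add: increment_outside[OF run step])
qed

lemma step_dual_value_le:
  "dual_value I (Suc i) (req_dual \<sigma>') (\<lambda>k. res_dual \<sigma>' k (Suc i)) \<le>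
    solution_value I (increment \<sigma> \<sigma>')"
proof -
  let ?P = "profitable I (price \<sigma>) (Suc i)" and ?y = "increment \<sigma> \<sigma>'"
  have P: "?P \<subseteq> requests I \<times> resources I" using profitable_subset batch_subset by blast
  have "dual_value I (Suc i) (req_dual \<sigma>') (\<lambda>k. res_dual \<sigma>' k (Suc i)) =
      primal_value I (price \<sigma>) (Suc i) ?y"
    using optimal_values_eq[OF increment_primal_optimal[OF run step] step_dual_optimal[OF run step]]
    by simp
  also have "\<dots> \<le> (\<Sum>(n, k)\<in>?P. reward I n k * ?y n k)"
    unfolding primal_value_def
  proof (rule sum_mono, clarify)
    fix n k assume "(n, k) \<in> ?P"
    then have "reduced_reward I (price \<sigma>) n k \<le> reward I n k"
      using run_cost_nonneg[OF run, of n k] P by (auto simp: reduced_reward_def)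
    then show "reduced_reward I (price \<sigma>) n k * ?y n k \<le> reward I n k * ?y n k"
      using increment_nonneg[OF run step] by (rule mult_right_mono)
  qed
  also have "\<dots> = (\<Sum>(n, k)\<in>requests I \<times> resources I. reward I n k * ?y n k)"
    using finite_requests finite_resources P increment_outside[OF run step]
    by (intro sum.mono_neutral_left) auto
  also have "\<dots> = solution_value I ?y" by (simp add: solution_value_def sum.cartesian_product)
  finally show ?thesis .
qed

lemma sum_req_dual_step:
  "(\<Sum>n\<in>requests I. req_dual \<sigma>' n) =
    (\<Sum>n\<in>requests I. req_dual \<sigma> n) + (\<Sum>n\<in>batch I (Suc i). req_dual \<sigma>' n)"
proof -
  have "(\<Sum>n\<in>batch I (Suc i). req_dual \<sigma> n) = 0"
    using run_duals_before_arrival(1)[OF run] by (simp add: batch_def)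
  moreover have "(\<Sum>n\<in>requests I - batch I (Suc i). req_dual \<sigma>' n) =
      (\<Sum>n\<in>requests I - batch I (Suc i). req_dual \<sigma> n)"
    by (rule sum.cong) (simp_all add: req_dual_step_unchanged[OF run step])
  ultimately show ?thesis
    using sum.subset_diff[OF batch_subset finite_requests, of "req_dual \<sigma>" "Suc i"]
      sum.subset_diff[OF batch_subset finite_requests, of "req_dual \<sigma>'" "Suc i"]
    by simp
qed

lemma sum_res_dual_step_le:
  assumes "k \<in> resources I"
  shows "(\<Sum>j\<in>time_slots I. res_dual \<sigma>' k j) \<le>
    (\<Sum>j\<in>time_slots I. res_dual \<sigma> k j) + res_dual \<sigma>' k (Suc i)"
proof -
  have "(\<Sum>j\<in>time_slots I. res_dual \<sigma>' k j) = (\<Sum>j\<in>time_slots I.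
      res_dual \<sigma> k j + (if j = Suc i then res_dual \<sigma>' k (Suc i) else 0))"
    using run_duals_before_arrival(2)[OF run] res_dual_step_unchanged[OF run step]
    by (intro sum.cong) auto
  then show ?thesis
    using assms step_dual_feasible[OF run step] finite_time_slots
    by (simp add: sum.distrib dual_feasible_def)
qed

end

end

context small_demand_instance
begin

lemma growth_le_linear:
  assumes k: "k \<in> resources I" and l: "0 \<le> l" "l \<le> doubling_load I k"
  shows "growth I k l \<le> 1 + 2 * (l * gam I k / capacity I k)"
  unfolding growth_def
proof (rule exp_le_one_plus_double)
  have "l * gam I k / capacity I k \<le> ln 2"
    using l(2) gam_pos[OF k] capacity_pos[OF k] by (simp add: doubling_load_def field_simps)
  also have "\<dots> \<le> 1" using ln_2_less_1 by simp
  finally show "l * gam I k / capacity I k \<le> 1" .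
qed (use l(1) gam_pos[OF k] capacity_pos[OF k] in simp)

context
  fixes i \<sigma> \<sigma>'
  assumes run: "alg_run I i \<sigma>" and step: "alg_step I (Suc i) \<sigma> \<sigma>'"
begin

lemma price_step_le:
  assumes k: "k \<in> resources I"
  shows "capacity I k * price \<sigma>' k t \<le> capacity I k * price \<sigma> k t +
    2 * gam I k * (shifted_price I (price \<sigma>) k t * load I (increment \<sigma> \<sigma>') k {t})"
proof -
  let ?l = "load I (increment \<sigma> \<sigma>') k {t}" and ?s = "shifted_price I (price \<sigma>) k t"
  have "growth I k ?l \<le> 1 + 2 * (?l * gam I k / capacity I k)"
    using k increment_nonneg[OF run step] increment_load_le[OF run step k]
    by (intro growth_le_linear load_nonneg)
  then have "?s * growth I k ?l \<le> ?s * (1 + 2 * (?l * gam I k / capacity I k))"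
    using run_shifted_price_nonneg[OF run k] by (rule mult_left_mono)
  then have "price \<sigma>' k t \<le> price \<sigma> k t + 2 * (?l * gam I k / capacity I k) * ?s"
    using shifted_price_step[OF run step, of k t] by (simp add: shifted_price_def algebra_simps)
  then show ?thesis using capacity_pos[OF k] by (simp add: field_simps)
qed

lemma sum_price_step_le:
  assumes k: "k \<in> resources I"
  shows "capacity I k * (\<Sum>t\<in>time_slots I. price \<sigma>' k t) \<le>
    capacity I k * (\<Sum>t\<in>time_slots I. price \<sigma> k t) +
      4 * gam I k * resource_value I (increment \<sigma> \<sigma>') k"
proof -
  let ?d = "\<lambda>t. shifted_price I (price \<sigma>) k t * load I (increment \<sigma> \<sigma>') k {t}"
  have "capacity I k * (\<Sum>t\<in>time_slots I. price \<sigma>' k t) \<le>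
      capacity I k * (\<Sum>t\<in>time_slots I. price \<sigma> k t) + 2 * gam I k * (\<Sum>t\<in>time_slots I. ?d t)"
    unfolding sum_distrib_left sum.distrib[symmetric] by (intro sum_mono price_step_le k)
  also have "2 * gam I k * (\<Sum>t\<in>time_slots I. ?d t) \<le>
      2 * gam I k * (2 * resource_value I (increment \<sigma> \<sigma>') k)"
    using sum_shifted_price_load_le[OF run step k] gam_pos[OF k] by (intro mult_left_mono) auto
  finally show ?thesis by simp
qed

lemma offline_dual_value_step_le:
  assumes G: "\<And>k. k \<in> resources I \<Longrightarrow> gam I k \<le> G"
  shows "offline_dual_value I (req_dual \<sigma>') (res_dual \<sigma>') (price \<sigma>') \<le>
    offline_dual_value I (req_dual \<sigma>) (res_dual \<sigma>) (price \<sigma>) +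
      (1 + 4 * G) * solution_value I (increment \<sigma> \<sigma>')"
proof -
  let ?K = "resources I" and ?T = "time_slots I" and ?y = "increment \<sigma> \<sigma>'"
  have res: "(\<Sum>k\<in>?K. real (quota I k) * (\<Sum>j\<in>?T. res_dual \<sigma>' k j)) \<le>
      (\<Sum>k\<in>?K. real (quota I k) * (\<Sum>j\<in>?T. res_dual \<sigma> k j)) +
        (\<Sum>k\<in>?K. real (quota I k) * res_dual \<sigma>' k (Suc i))"
    unfolding sum.distrib[symmetric] distrib_left[symmetric]
    by (intro sum_mono mult_left_mono sum_res_dual_step_le[OF run step]) auto
  have "resource_value I ?y k \<ge> 0" if "k \<in> ?K" for k
    unfolding resource_value_def using reward_nonneg[OF _ that] increment_nonneg[OF run step]
    by (intro sum_nonneg mult_nonneg_nonneg)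
  then have "(\<Sum>k\<in>?K. 4 * gam I k * resource_value I ?y k) \<le> 4 * G * solution_value I ?y"
    unfolding solution_value_conv_resource_value sum_distrib_left using G
    by (intro sum_mono mult_right_mono) auto
  moreover have "(\<Sum>k\<in>?K. capacity I k * (\<Sum>t\<in>?T. price \<sigma>' k t)) \<le>
      (\<Sum>k\<in>?K. capacity I k * (\<Sum>t\<in>?T. price \<sigma> k t)) + (\<Sum>k\<in>?K. 4 * gam I k * resource_value I ?y k)"
    unfolding sum.distrib[symmetric] by (intro sum_mono sum_price_step_le)
  ultimately show ?thesis
    using res step_dual_value_le[OF run step]
    by (simp add: offline_dual_value_def sum_req_dual_step[OF run step] dual_value_def distrib_right)
qed

end

lemma run_offline_dual_value_le:
  assumes "alg_run I i \<sigma>" and G: "\<And>k. k \<in> resources I \<Longrightarrow> gam I k \<le> G"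
  shows "offline_dual_value I (req_dual \<sigma>) (res_dual \<sigma>) (price \<sigma>) \<le>
    (1 + 4 * G) * solution_value I (sol \<sigma>)"
  using assms(1)
proof (induction rule: alg_run.induct)
  case init
  show ?case by (simp add: init_state_def offline_dual_value_def solution_value_def)
next
  case (step i \<sigma> \<sigma>')
  have "solution_value I (sol \<sigma>') = solution_value I (sol \<sigma>) + solution_value I (increment \<sigma> \<sigma>')"
    by (simp add: solution_value_def increment_def right_diff_distrib sum_subtractf)
  then show ?case
    using offline_dual_value_step_le[OF step.hyps G] step.IH by (simp add: distrib_left)
qed

theorem offline_opt_le:
  assumes out: "alg_output I x"
  shows "offline_opt I \<le>
    (1 + 8 * ln (2 + 4 * (theta_ratio_max I * dur_ratio_max I))) * solution_value I x"
proof -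
  define G where "G = 2 * ln (2 + 4 * (theta_ratio_max I * dur_ratio_max I))"
  obtain \<sigma> where run: "alg_run I (horizon I) \<sigma>" and x: "x = sol \<sigma>"
    using out by (auto simp: alg_output_def)
  have "solution_value I y \<le> (1 + 4 * G) * solution_value I x" if "feasible I y" for y
  proof -
    have "solution_value I y \<le> offline_dual_value I (req_dual \<sigma>) (res_dual \<sigma>) (price \<sigma>)"
      using that run_offline_dual_feasible[OF run] by (rule offline_weak_duality)
    also have "\<dots> \<le> (1 + 4 * G) * solution_value I x"
      unfolding x using run gam_le by (intro run_offline_dual_value_le) (simp_all add: G_def)
    finally show ?thesis .
  qed
  then show ?thesis
    unfolding offline_opt_def using finite_feasible_values alg_output_feasible[OF out]
    by (subst Max_le_iff) (auto simp: G_def)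
qed

end

theorem theorem2:
  shows "(\<forall>I. admissible I \<and> small_demands I \<longrightarrow>
            (\<exists>x. alg_output I x) \<and> (\<forall>x. alg_output I x \<longrightarrow> feasible I x)) \<and>
         (\<exists>\<alpha> :: real \<Rightarrow> real. \<alpha> \<in> O[at_top](\<lambda>y. ln y) \<and>
            (\<forall>y. competitive_ratio
                   {I. admissible I \<and> small_demands I \<and> theta_ratio_max I * dur_ratio_max I = y}
                   (\<alpha> y)))"
proof (intro conjI allI impI exI[of _ "\<lambda>y. 1 + 8 * ln (2 + 4 * y)"])
  fix I assume "admissible I \<and> small_demands I"
  then interpret small_demand_instance I by unfold_locales auto
  show "\<exists>x. alg_output I x" by (rule alg_output_exists)
  show "feasible I x" if "alg_output I x" for x using that by (rule alg_output_feasible)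
next
  show "(\<lambda>y :: real. 1 + 8 * ln (2 + 4 * y)) \<in> O[at_top](\<lambda>y. ln y)" by real_asymp
next
  fix y
  have "offline_opt I \<le> (1 + 8 * ln (2 + 4 * y)) * solution_value I x"
    if "admissible I" "small_demands I" "theta_ratio_max I * dur_ratio_max I = y" "alg_output I x"
    for I x
  proof -
    interpret small_demand_instance I using that by unfold_locales
    show ?thesis using offline_opt_le that by blast
  qed
  then show "competitive_ratio
      {I. admissible I \<and> small_demands I \<and> theta_ratio_max I * dur_ratio_max I = y}
      (1 + 8 * ln (2 + 4 * y))"
    by (simp add: competitive_ratio_def)
qed

end
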